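(* The circular measures of the finite ADE graphs (rooted as described in the context) are given by the following formulae: (1) $A_{n-1}\to\alpha_n$, for $n\ge 3$. (2) $\tilde{A}_{2n}\to d_n$, for $n\ge 1$. (3) $D_{n+1}\to\alpha_n'$, for $n\ge 2$. (4) $\tilde{D}_{n+2}\to (d_n+d_1')/2$, for $n\ge 2$. (5) $E_6\to\alpha_{12}+(d_{12}-d_6-d_4+d_3)/2$. (6) $E_7\to\beta_9'+(d_1'-d_3')/2$. (7) $E_8\to\alpha_{15}'+\gamma_{15}'-(d_5'+d_3')/2$. (8) $\tilde{E}_{n+3}\to (d_n+d_3+d_2-d_1)/2$, for $n=3,4,5$.
   Context: Circular measure. Let $X$ be a finite rooted bipartite graph (multiple edges allowed) and let $c_k$ be the number of loops of length $2k$ on $X$ based at the root (counted with edge multiplicity). The real measure of $X$ is the probability measure $\mu$ on $[0,\infty)$ with $\int x^k\,d\mu(x)=c_k$ for all $k\ge 0$; equivalently, it is the spectral measure of the square of the adjacency matrix with respect to the (root, root) entry. Write $\mu=\sum_i p_i\delta_{x_i}$. For each $i$ the equation $(q+q^{-1})^2=x_i$ has the solutions $q_i,q_i^{-1},-q_i,-q_i^{-1}$ (with multiplicity), and the circular measure of $X$ is $$\varepsilon=\frac14\sum_i p_i(\delta_{q_i}+\delta_{q_i^{-1}}+\delta_{-q_i}+\delta_{-q_i^{-1}}).$$ Measures. For $n\ge1$, $d_n$ is the uniform probability measure on the $2n$-th roots of unity, and $d_n'=2d_{2n}-d_n$ is the uniform probability measure on the odd $4n$-roots of unity (the $4n$-th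 roots of unity that are odd powers of $e^{\pi i/(2n)}$). For a function $\lambda:\mathbb T\to\mathbb R$ on the unit circle, $\lambda_n=\lambda\,d_n$ and $\lambda_n'=\lambda\,d_n'$ (the measures with density $\lambda$ with respect to $d_n$, respectively $d_n'$). The densities are $\alpha(q)={\rm Re}(1-q^2)$, $\beta(q)={\rm Re}(1-q^4)$, $\gamma(q)={\rm Re}(1-q^6)$. Graphs. $A_n$ ($n\ge2$): path with $n$ vertices, rooted at an end vertex. $D_n$ ($n\ge 3$): path $v_1,\dots,v_{n-2}$ with two extra leaves attached to $v_{n-2}$, rooted at $v_1$. $\tilde A_{2n}$ ($n\ge1$): cycle with $2n$ vertices, rooted at a vertex (for $n=1$: two vertices joined by a double edge). $\tilde D_n$ ($n\ge4$): path $v_1,\dots,v_{n-3}$ with two extra leaves attached to $v_1$ and two extra leaves attached to $v_{n-3}$ (for $n=4$: one vertex with four leaves), rooted at one of the four leaves. The exceptional graphs are trees with one central vertex and three legs (paths attached to the central vertex), with the following numbers of vertices in the legs: $E_6$: $(2,1,2)$; $E_7$: $(3,1,2)$; $E_8$: $(4,1,2)$; $\tilde E_6$: $(2,2,2)$; $\tilde E_7$: $(3,1,3)$; $\tilde E_8$: $(5,1,2)$; each is rooted at the end vertex of a leg of maximal length. *)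

theory Defs
  imports "HOL-Probability.Probability"
begin

section \<open>Rooted multigraphs\<close>

text \<open>
  Edges are a multiset of two-element vertex sets, so the number of edges joining \<open>u\<close> and \<open>v\<close>
  is \<open>count (edges X) {u, v}\<close>.
\<close>

record 'v rooted_graph =
  verts :: "'v set"
  edges :: "'v set multiset"
  root :: 'v

definition finite_rooted_bipartite :: "'v rooted_graph \<Rightarrow> bool" where
  "finite_rooted_bipartite X \<longleftrightarrow> finite (verts X) \<and> root X \<in> verts X \<and>
     (\<exists>U W. U \<union> W = verts X \<and> U \<inter> W = {} \<and> (\<forall>e \<in># edges X. \<exists>u\<in>U. \<exists>w\<in>W. e = {u, w}))"

text \<open>
  Vertex sequences of closed walks at the root. A sequence is weighted by the number of ways to
  choose its edges (possibly zero), so that \<open>loop_count X n\<close> counts the loops of length \<open>n\<close>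
  with edge multiplicity.
\<close>

definition root_seqs :: "'v rooted_graph \<Rightarrow> nat \<Rightarrow> 'v list set" where
  "root_seqs X n = {w. length w = Suc n \<and> set w \<subseteq> verts X \<and> hd w = root X \<and> last w = root X}"

definition loop_count :: "'v rooted_graph \<Rightarrow> nat \<Rightarrow> nat" where
  "loop_count X n = (\<Sum>w \<in> root_seqs X n. \<Prod>i<n. count (edges X) {w ! i, w ! Suc i})"


section \<open>Real and circular measure\<close>

definition is_real_measure :: "'v rooted_graph \<Rightarrow> real measure \<Rightarrow> bool" where
  "is_real_measure X \<mu> \<longleftrightarrow> prob_space \<mu> \<and> sets \<mu> = sets borel \<and> (AE x in \<mu>. 0 \<le> x) \<and>
     (\<forall>k. integrable \<mu> (\<lambda>x. x ^ k) \<and> (LINT x|\<mu>. x ^ k) = real (loop_count X (2 * k)))"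

definition real_measure :: "'v rooted_graph \<Rightarrow> real measure" where
  "real_measure X = (THE \<mu>. is_real_measure X \<mu>)"

text \<open>
  One solution of \<open>(q + 1/q)\<^sup>2 = x\<close>; the four solutions with multiplicity are \<open>q\<close>, \<open>1/q\<close>,
  \<open>-q\<close>, \<open>-1/q\<close>, whichever one is chosen. The condition \<open>q \<noteq> 0\<close> is needed because
  \<open>inverse 0 = 0\<close> would make \<open>0\<close> a solution for \<open>x = 0\<close>.
\<close>

definition circ_root :: "real \<Rightarrow> complex" where
  "circ_root x = (SOME q. q \<noteq> 0 \<and> (q + inverse q)\<^sup>2 = of_real x)"

text \<open>
  Finite signed measures on the complex plane are given by their values on sets; all those
  occurring here are finitely supported, so every set is measurable. The value of the Dirac mass
  at \<open>q\<close> on \<open>S\<close> is \<open>indicator S q\<close>. The sum runs over the atoms of the real measure, of which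
  there are finitely many for a finite graph.
\<close>

type_synonym signed_measure = "complex set \<Rightarrow> real"

definition circular_measure :: "'v rooted_graph \<Rightarrow> signed_measure" where
  "circular_measure X = (\<lambda>S. 1/4 * (\<Sum>x | measure (real_measure X) {x} \<noteq> 0.
     measure (real_measure X) {x} *
       (let q = circ_root x in
          indicator S q + indicator S (inverse q) + indicator S (- q) + indicator S (- inverse q))))"


section \<open>Measures on roots of unity\<close>

definition d_unif :: "nat \<Rightarrow> complex measure" where
  "d_unif n = measure_pmf (pmf_of_set {q. q ^ (2 * n) = 1})"

definition d_odd :: "nat \<Rightarrow> complex measure" where
  "d_odd n = measure_pmf (pmf_of_set {exp (\<i> * of_real pi / of_nat (2 * n)) ^ k | k. odd k})"

definition with_density :: "(complex \<Rightarrow> real) \<Rightarrow> complex measure \<Rightarrow> signed_measure" where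
  "with_density l M = (\<lambda>S. LINT q:S|M. l q)"

definition alpha :: "complex \<Rightarrow> real" where "alpha q = Re (1 - q ^ 2)"
definition beta :: "complex \<Rightarrow> real" where "beta q = Re (1 - q ^ 4)"
definition gamma :: "complex \<Rightarrow> real" where "gamma q = Re (1 - q ^ 6)"


section \<open>The ADE graphs\<close>

abbreviation path_edges :: "nat \<Rightarrow> nat \<Rightarrow> nat set multiset" where
  "path_edges a b \<equiv> {# {i, Suc i}. i \<in># mset_set {a..<b} #}"

definition A_graph :: "nat \<Rightarrow> nat rooted_graph" where
  "A_graph n = \<lparr>verts = {1..n}, edges = path_edges 1 n, root = 1\<rparr>"

definition D_graph :: "nat \<Rightarrow> nat rooted_graph" where
  "D_graph n = \<lparr>verts = {1..n},
     edges = path_edges 1 (n - 2) + {# {n - 2, n - 1}, {n - 2, n} #}, root = 1\<rparr>"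

text \<open>
  The cycle with \<open>m\<close> vertices (\<open>m\<close> even). For \<open>m = 2\<close> the edge \<open>{0, 1}\<close> arises twice.
\<close>

definition A_tilde_graph :: "nat \<Rightarrow> nat rooted_graph" where
  "A_tilde_graph m = \<lparr>verts = {..<m},
     edges = {# {i, Suc i mod m}. i \<in># mset_set {..<m} #}, root = 0\<rparr>"

text \<open>The path is \<open>1, \<dots>, n - 3\<close>, the leaves are \<open>n - 2, \<dots>, n + 1\<close>.\<close>

definition D_tilde_graph :: "nat \<Rightarrow> nat rooted_graph" where
  "D_tilde_graph n = \<lparr>verts = {1..n + 1},
     edges = path_edges 1 (n - 3) +
       {# {1, n - 2}, {1, n - 1}, {n - 3, n}, {n - 3, n + 1} #}, root = n - 2\<rparr>"

text \<open>
  Central vertex \<open>0\<close> and legs \<open>1, \<dots>, a\<close> and \<open>a + 1, \<dots>, a + b\<close> and \<open>a + b + 1, \<dots>, a + b + c\<close>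
  numbered away from the centre (all nonempty), rooted at the end of the first leg.
\<close>

definition three_legs :: "nat \<Rightarrow> nat \<Rightarrow> nat \<Rightarrow> nat rooted_graph" where
  "three_legs a b c = \<lparr>verts = {0..a + b + c},
     edges = {# {0, 1}, {0, a + 1}, {0, a + b + 1} #} +
       path_edges 1 a + path_edges (a + 1) (a + b) + path_edges (a + b + 1) (a + b + c),
     root = a\<rparr>"

definition "E6_graph = three_legs 2 1 2"
definition "E7_graph = three_legs 3 1 2"
definition "E8_graph = three_legs 4 1 2"

text \<open>Only used for \<open>m = 6, 7, 8\<close>.\<close>

definition E_tilde_graph :: "nat \<Rightarrow> nat rooted_graph" where
  "E_tilde_graph m =
     (if m = 6 then three_legs 2 2 2 else if m = 7 then three_legs 3 1 3 else three_legs 5 1 2)"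


section \<open>Consistency of the definitions\<close>

lemma finite_rooted_bipartiteI:
  assumes "finite (verts X)" "root X \<in> verts X"
    and "\<forall>e \<in># edges X. \<exists>u\<in>verts X. \<exists>v\<in>verts X. e = {u, v} \<and> c u = (\<not> c v)"
  shows "finite_rooted_bipartite X"
proof -
  have "{v \<in> verts X. c v} \<union> {v \<in> verts X. \<not> c v} = verts X"
    "{v \<in> verts X. c v} \<inter> {v \<in> verts X. \<not> c v} = {}" by auto
  moreover have "\<forall>e\<in>#edges X. \<exists>u\<in>{v \<in> verts X. c v}. \<exists>w\<in>{v \<in> verts X. \<not> c v}. e = {u, w}"
  proof
    fix e assume "e \<in># edges X"
    then obtain u v where uv: "u \<in> verts X" "v \<in> verts X" "e = {u, v}" "c u = (\<not> c v)"
      using assms(3) by blast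
    then have "e = {v, u}" by (simp add: insert_commute)
    with uv show "\<exists>u\<in>{v \<in> verts X. c v}. \<exists>w\<in>{v \<in> verts X. \<not> c v}. e = {u, w}"
      by (cases "c u") blast+
  qed
  ultimately show ?thesis unfolding finite_rooted_bipartite_def using assms(1,2) by blast
qed

lemma edge_ok:
  assumes "u \<in> V" "v \<in> V" "c u = (\<not> c v)"
  shows "\<exists>u'\<in>V. \<exists>v'\<in>V. {u, v} = {u', v'} \<and> c u' = (\<not> c v')"
  using assms by blast

lemma path_edges_ok:
  assumes "\<And>i. a \<le> i \<Longrightarrow> i < b \<Longrightarrow> i \<in> V \<and> Suc i \<in> V \<and> c i = (\<not> c (Suc i))"
  shows "\<forall>e \<in># path_edges a b. \<exists>u\<in>V. \<exists>v\<in>V. e = {u, v} \<and> c u = (\<not> c v)"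
  using assms by (auto intro!: edge_ok)

lemma bipartite_A: "n \<ge> 1 \<Longrightarrow> finite_rooted_bipartite (A_graph n)"
  unfolding A_graph_def
  by (rule finite_rooted_bipartiteI[where c = even], simp_all only: rooted_graph.simps)
     (simp, simp, rule path_edges_ok, simp)

lemma bipartite_A_tilde: "n \<ge> 1 \<Longrightarrow> finite_rooted_bipartite (A_tilde_graph (2 * n))"
proof (rule finite_rooted_bipartiteI[where c = even])
  assume n: "n \<ge> 1"
  show "finite (verts (A_tilde_graph (2 * n)))" "root (A_tilde_graph (2 * n)) \<in> verts (A_tilde_graph (2 * n))"
    using n by (simp_all add: A_tilde_graph_def)
  have parity: "even i = (\<not> even (Suc i mod (2 * n)))" for i by (simp add: dvd_mod_iff)
  show "\<forall>e \<in># edges (A_tilde_graph (2 * n)). \<exists>u\<in>verts (A_tilde_graph (2 * n)).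
      \<exists>v\<in>verts (A_tilde_graph (2 * n)). e = {u, v} \<and> even u = (\<not> even v)"
  proof
    fix e assume "e \<in># edges (A_tilde_graph (2 * n))"
    then obtain i where i: "i < 2 * n" "e = {i, Suc i mod (2 * n)}"
      by (auto simp: A_tilde_graph_def)
    moreover have "Suc i mod (2 * n) < 2 * n" using n by simp
    ultimately show "\<exists>u\<in>verts (A_tilde_graph (2 * n)).
        \<exists>v\<in>verts (A_tilde_graph (2 * n)). e = {u, v} \<and> even u = (\<not> even v)"
      unfolding i(2) using parity[of i]
      by (intro edge_ok) (simp_all only: A_tilde_graph_def rooted_graph.simps lessThan_iff)
  qed
qed

lemma bipartite_D:
  assumes "n \<ge> 3"
  shows "finite_rooted_bipartite (D_graph n)"
proof -
  define c where "c i = (if i = n then odd n else even i)" for i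
  show ?thesis
  proof (rule finite_rooted_bipartiteI[where c = c])
    show "finite (verts (D_graph n))" "root (D_graph n) \<in> verts (D_graph n)"
      using assms by (simp_all add: D_graph_def)
    show "\<forall>e \<in># edges (D_graph n). \<exists>u\<in>verts (D_graph n).
        \<exists>v\<in>verts (D_graph n). e = {u, v} \<and> c u = (\<not> c v)"
      unfolding D_graph_def rooted_graph.simps set_mset_union ball_Un
        set_mset_add_mset_insert set_mset_empty Set.ball_simps(5,7)
      by (intro conjI path_edges_ok edge_ok TrueI) (use assms in \<open>auto simp: c_def\<close>)
  qed
qed

lemma bipartite_D_tilde:
  assumes "n \<ge> 4"
  shows "finite_rooted_bipartite (D_tilde_graph n)"
proof -
  define c where "c i = (if i \<le> n - 3 then even i else if i \<le> n - 1 then True else even n)" for i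
  show ?thesis
  proof (rule finite_rooted_bipartiteI[where c = c])
    show "finite (verts (D_tilde_graph n))" "root (D_tilde_graph n) \<in> verts (D_tilde_graph n)"
      unfolding D_tilde_graph_def rooted_graph.simps atLeastAtMost_iff using assms by (simp, linarith)
    show "\<forall>e \<in># edges (D_tilde_graph n). \<exists>u\<in>verts (D_tilde_graph n).
        \<exists>v\<in>verts (D_tilde_graph n). e = {u, v} \<and> c u = (\<not> c v)"
      unfolding D_tilde_graph_def rooted_graph.simps set_mset_union ball_Un
        set_mset_add_mset_insert set_mset_empty Set.ball_simps(5,7)
      by (intro conjI path_edges_ok edge_ok TrueI) (use assms in \<open>auto simp: c_def\<close>)
  qed
qed

lemma bipartite_three_legs:
  assumes "a \<ge> 1" "b \<ge> 1" "c \<ge> 1"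
  shows "finite_rooted_bipartite (three_legs a b c)"
proof -
  define k where "k i = (if i \<le> a then even i else if i \<le> a + b then even (i - a)
    else even (i - a - b))" for i
  show ?thesis
  proof (rule finite_rooted_bipartiteI[where c = k])
    show "finite (verts (three_legs a b c))" "root (three_legs a b c) \<in> verts (three_legs a b c)"
      by (simp_all add: three_legs_def)
    show "\<forall>e \<in># edges (three_legs a b c). \<exists>u\<in>verts (three_legs a b c).
        \<exists>v\<in>verts (three_legs a b c). e = {u, v} \<and> k u = (\<not> k v)"
      unfolding three_legs_def rooted_graph.simps set_mset_union ball_Un
        set_mset_add_mset_insert set_mset_empty Set.ball_simps(5,7)
      by (intro conjI path_edges_ok edge_ok TrueI)
         (use assms in \<open>auto simp: k_def Suc_diff_le\<close>)
  qed
qed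

lemma exp_pi_power_2n:
  assumes "n \<ge> 1"
  shows "exp (\<i> * of_real pi / of_nat (2 * n)) ^ (2 * n) = (-1 :: complex)"
proof -
  have "exp (\<i> * of_real pi / of_nat (2 * n)) ^ (2 * n)
      = exp (of_nat (2 * n) * (\<i> * of_real pi / of_nat (2 * n)) :: complex)"
    by (rule exp_of_nat_mult [symmetric])
  also have "of_nat (2 * n) * (\<i> * of_real pi / of_nat (2 * n)) = (\<i> * of_real pi :: complex)"
    using assms by (simp add: field_simps)
  finally show ?thesis by simp
qed

lemma odd_powers_eq:
  assumes "n \<ge> 1"
  shows "{exp (\<i> * of_real pi / of_nat (2 * n)) ^ k | k. odd k} = {q :: complex. q ^ (2 * n) = -1}"
proof (intro equalityI subsetI)
  fix q :: complex
  let ?z = "exp (\<i> * of_real pi / of_nat (2 * n)) :: complex"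
  {
    assume "q \<in> {?z ^ k | k. odd k}"
    then obtain k where k: "q = ?z ^ k" "odd k" by blast
    have "q ^ (2 * n) = (?z ^ (2 * n)) ^ k" unfolding k(1) by (simp only: power_mult [symmetric] mult.commute)
    then show "q \<in> {q. q ^ (2 * n) = -1}"
      unfolding exp_pi_power_2n[OF assms] using k by simp
  }
  assume q: "q \<in> {q. q ^ (2 * n) = -1}"
  have "(q ^ (2 * n)) ^ 2 = 1" using q by simp
  then have "q ^ (4 * n) = 1" by (simp add: power_mult [symmetric] mult.commute)
  then obtain j where j: "q = exp (2 * of_real pi * \<i> * of_nat j / of_nat (4 * n))"
    using complex_roots_unity[of "4 * n"] assms by auto
  have eq: "q = ?z ^ j"
    unfolding j exp_of_nat_mult [symmetric] using assms by (simp add: field_simps)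
  have "q ^ (2 * n) = (?z ^ (2 * n)) ^ j" unfolding eq by (simp only: power_mult [symmetric] mult.commute)
  then have "(-1 :: complex) ^ j = -1" using q exp_pi_power_2n[OF assms] by simp
  then have "odd j" by (metis neg_one_even_power one_neq_neg_one)
  then show "q \<in> {?z ^ k | k. odd k}" using eq by blast
qed

lemma d_odd_eq:
  assumes "n \<ge> 1"
  shows "measure (d_odd n) S = 2 * measure (d_unif (2 * n)) S - measure (d_unif n) S"
proof -
  let ?P = "{q :: complex. q ^ (2 * n) = 1}"
  let ?M = "{q :: complex. q ^ (2 * n) = -1}"
  let ?Q = "{q :: complex. q ^ (2 * (2 * n)) = 1}"
  have Q: "?Q = ?P \<union> ?M" "?P \<inter> ?M = {}"
  proof -
    have "q ^ (2 * (2 * n)) = (q ^ (2 * n))\<^sup>2" for q :: complex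
      by (simp add: power_mult [symmetric] mult.commute)
    then show "?Q = ?P \<union> ?M" by (auto simp: power2_eq_1_iff)
  qed auto
  have cP: "card ?P = 2 * n" "finite ?P" and cQ: "card ?Q = 4 * n" "finite ?Q"
    using card_roots_unity_eq[of "2 * n"] card_roots_unity_eq[of "2 * (2 * n)"] assms
      finite_roots_unity[of "2 * n", where 'a = complex]
      finite_roots_unity[of "2 * (2 * n)", where 'a = complex] by auto
  have fM: "finite ?M" using Q(1) cQ(2) by (metis finite_Un)
  have "card ?Q = card ?P + card ?M" unfolding Q(1) by (rule card_Un_disjoint[OF cP(2) fM Q(2)])
  then have cM: "card ?M = 2 * n" using cP cQ by simp
  have ne: "?P \<noteq> {}" "?M \<noteq> {}" "?Q \<noteq> {}" using cP cM cQ assms by (metis card.empty mult_eq_0_iff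
        not_one_le_zero zero_neq_numeral)+
  have "card (?Q \<inter> S) = card ((?P \<inter> S) \<union> (?M \<inter> S))" unfolding Q(1) by (simp add: Int_Un_distrib2)
  also have "\<dots> = card (?P \<inter> S) + card (?M \<inter> S)"
    by (rule card_Un_disjoint) (use cP fM Q(2) in auto)
  finally have s: "card (?Q \<inter> S) = card (?P \<inter> S) + card (?M \<inter> S)" .
  show ?thesis
    unfolding d_odd_def d_unif_def odd_powers_eq[OF assms]
      measure_pmf_of_set[OF ne(1) cP(2)] measure_pmf_of_set[OF ne(2) fM]
      measure_pmf_of_set[OF ne(3) cQ(2)] s cP(1) cM cQ(1)
    using assms by (simp add: field_simps)
qed

end

theory Submission
  imports Defs
begin

text \<open>
  Why the formulae hold. All the measures are finite sums \<open>\<Sum>q. w q \<delta>\<^sub>q\<close> over roots of unity of a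
  fixed order, so a formula says that a certain weight function \<open>w\<close> is the circular measure of the
  graph. For \<open>q\<close> on the unit circle \<open>q + 1/q = 2 Re q\<close>, so \<open>w\<close> is the circular measure as soon as it
  is nonnegative, invariant under \<open>q \<mapsto> -q\<close> and \<open>q \<mapsto> 1/q\<close>, and the \<open>2k\<close>-th moment of \<open>2 Re q\<close> under
  \<open>w\<close> is the number of loops of length \<open>2k\<close> (\<open>circular_measure_from_weights\<close>). Indeed the real
  measure is then the image of \<open>w\<close> under \<open>q \<mapsto> (2 Re q)\<^sup>2\<close>, because a finitely supported measure is
  determined by its moments (\<open>finitely_supported_moment_determinacy\<close>), and each fibre of this map is
  an orbit \<open>q, 1/q, -q, -1/q\<close>, over which the circular measure spreads the mass evenly.

  The moments come from linear algebra. Suppose the basis vector at the root is a sum of vectors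
  \<open>h\<^sub>q\<close>, each satisfying the eigenvector equation of the adjacency matrix for \<open>2 Re q\<close>. Applying the
  \<open>n\<close>-th power of the matrix and reading off the root entry expresses the number of loops of length
  \<open>n\<close> as \<open>\<Sum>q. h\<^sub>q(root) (2 Re q)\<^sup>n\<close> (\<open>loop_count_spectral\<close>), so \<open>w q\<close> is the root entry of \<open>h\<^sub>q\<close>. The
  vectors are written down explicitly. Except for the graphs tilde D they have the form
  \<open>h\<^sub>q(v) = w q f\<^sub>v(q)\<close> where \<open>f\<^sub>v\<close> is \<open>1\<close> for the root and in general a linear combination of the functions
  \<open>tr j q = q\<^sup>j + q\<^sup>-\<^sup>j\<close>. Two things are then left to check for each graph
  (\<open>circular_measure_from_eigenfunctions\<close>). The eigenvector equations on the support of \<open>w\<close>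
  follow from \<open>tr 1 q * tr j q = tr (j + 1) q + tr (j - 1) q\<close> and from one relation that the points of
  the support satisfy. The orthogonality relations \<open>\<Sum>q. w q f\<^sub>v(q) = 0\<close> for \<open>v\<close> different from the root
  follow from the fact that a nontrivial power sum over roots of unity vanishes.

  Along the path that starts at the root the eigenvector equation forces the \<open>f\<^sub>v\<close> to be Chebyshev
  polynomials of the second kind in \<open>2 Re q\<close>. Multiplication by the density
  \<open>alpha\<close> turns them into differences of two \<open>tr j q\<close> (\<open>alpha_cheb\<close>).
  For the trees with three legs the remaining \<open>f\<^sub>v\<close> are the polynomials \<open>p\<close> of least degree for which
  \<open>p\<close>(adjacency matrix) maps the basis vector at the root to the orthogonal projection
  of the basis vector at \<open>v\<close> to the cyclic subspace of the root.
  Nonnegativity of \<open>w\<close> is not obvious for the exceptional graphs, whose formulae involve differences.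
  For \<open>E\<^sub>6\<close>, \<open>E\<^sub>7\<close> and \<open>E\<^sub>8\<close> the summands cancel at precisely those points of low order that do not
  belong to the spectrum, and \<open>w\<close> is positive at
  the other points where one of the summands is supported.
\<close>

section \<open>Closed walks and eigenvectors\<close>

text \<open>
  The product of the adjacency matrix with the vector \<open>g\<close>, read off at \<open>v\<close>. It is kept separate
  from the graph record so that edge multisets can be taken apart.
\<close>

definition nbr_sum :: "'v set \<Rightarrow> 'v set multiset \<Rightarrow> ('v \<Rightarrow> real) \<Rightarrow> 'v \<Rightarrow> real" where
  "nbr_sum V E g v = (\<Sum>u\<in>V. real (count E {v, u}) * g u)"

definition walks :: "'v rooted_graph \<Rightarrow> nat \<Rightarrow> 'v list set" where
  "walks X n = {w. length w = Suc n \<and> set w \<subseteq> verts X \<and> hd w = root X}"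

definition walk_weight :: "'v rooted_graph \<Rightarrow> 'v list \<Rightarrow> real" where
  "walk_weight X w = (\<Prod>i<length w - 1. real (count (edges X) {w ! i, w ! Suc i}))"

lemma finite_walks: "finite (verts X) \<Longrightarrow> finite (walks X n)"
  by (rule finite_subset[OF _ finite_lists_length_eq[of "verts X" "Suc n"]]) (auto simp: walks_def)

lemma walks_Suc: "walks X (Suc n) = (\<lambda>(w, u). w @ [u]) ` (walks X n \<times> verts X)"
proof (intro equalityI subsetI)
  fix w assume w: "w \<in> walks X (Suc n)"
  then have ne: "w \<noteq> []" and l: "length (butlast w) = Suc n" by (auto simp: walks_def)
  have "hd (butlast w) = hd w" using ne l by (cases w) auto
  then have "butlast w \<in> walks X n" "last w \<in> verts X"
    using w ne l by (auto simp: walks_def dest: in_set_butlastD)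
  with ne show "w \<in> (\<lambda>(w, u). w @ [u]) ` (walks X n \<times> verts X)"
    by (intro image_eqI[of _ _ "(butlast w, last w)"]) auto
next
  fix w assume "w \<in> (\<lambda>(w, u). w @ [u]) ` (walks X n \<times> verts X)"
  then show "w \<in> walks X (Suc n)" by (auto simp: walks_def hd_append)
qed

lemma walk_weight_snoc:
  assumes "w \<noteq> []"
  shows "walk_weight X (w @ [u]) = walk_weight X w * real (count (edges X) {last w, u})"
proof -
  obtain n where n: "length w = Suc n" using assms by (cases w) auto
  have "(\<Prod>i<n. real (count (edges X) {(w @ [u]) ! i, (w @ [u]) ! Suc i}))
      = (\<Prod>i<n. real (count (edges X) {w ! i, w ! Suc i}))"
    by (rule prod.cong) (simp_all add: nth_append n)
  then show ?thesis
    using assms by (simp add: walk_weight_def n nth_append last_conv_nth)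
qed

text \<open>
  Both sides are the root entry of the \<open>n\<close>-th power of the adjacency matrix applied to \<open>g\<close>; the
  induction extends walks at their end, where the eigenvector equation collapses the sum over the new vertex.
\<close>

lemma eigenvector_walk_sum:
  assumes r: "root X \<in> verts X"
    and eig: "\<And>v. v \<in> verts X \<Longrightarrow> nbr_sum (verts X) (edges X) g v = l * g v"
  shows "(\<Sum>w\<in>walks X n. walk_weight X w * g (last w)) = l ^ n * g (root X)"
proof (induction n)
  case 0
  have "walks X 0 = {[root X]}"
    using r by (auto simp: walks_def length_Suc_conv)
  then show ?case by (simp add: walk_weight_def)
next
  case (Suc n)
  have inj: "inj_on (\<lambda>(w, u). w @ [u]) (walks X n \<times> verts X)" by (auto simp: inj_on_def)
  have "(\<Sum>w\<in>walks X (Suc n). walk_weight X w * g (last w))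
      = (\<Sum>(w, u)\<in>walks X n \<times> verts X. walk_weight X (w @ [u]) * g u)"
    unfolding walks_Suc sum.reindex[OF inj] by (simp add: case_prod_unfold)
  also have "\<dots> = (\<Sum>w\<in>walks X n. \<Sum>u\<in>verts X. walk_weight X (w @ [u]) * g u)"
    by (simp add: sum.cartesian_product)
  also have "\<dots> = (\<Sum>w\<in>walks X n. walk_weight X w * nbr_sum (verts X) (edges X) g (last w))"
  proof (rule sum.cong)
    fix w assume "w \<in> walks X n"
    then have "w \<noteq> []" by (auto simp: walks_def)
    then show "(\<Sum>u\<in>verts X. walk_weight X (w @ [u]) * g u)
        = walk_weight X w * nbr_sum (verts X) (edges X) g (last w)"
      by (simp add: walk_weight_snoc nbr_sum_def sum_distrib_left mult.assoc)
  qed simp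
  also have "\<dots> = (\<Sum>w\<in>walks X n. l * (walk_weight X w * g (last w)))"
  proof (rule sum.cong)
    fix w assume "w \<in> walks X n"
    then have "last w \<in> verts X" by (cases w rule: rev_cases) (auto simp: walks_def)
    then show "walk_weight X w * nbr_sum (verts X) (edges X) g (last w)
        = l * (walk_weight X w * g (last w))" by (simp add: eig)
  qed simp
  also have "\<dots> = l ^ Suc n * g (root X)" by (simp add: sum_distrib_left[symmetric] Suc.IH)
  finally show ?case .
qed

text \<open>
  The hypothesis \<open>unit\<close> writes the basis vector at the root as a sum of eigenvectors, one for each
  index; only walks that return to the root then survive in the sum over all walks.
\<close>

lemma loop_count_spectral:
  assumes fin: "finite (verts X)" and r: "root X \<in> verts X"
    and eig: "\<And>i v. i \<in> I \<Longrightarrow> v \<in> verts X \<Longrightarrow>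
      nbr_sum (verts X) (edges X) (\<lambda>u. h u i) v = l i * h v i"
    and unit: "\<And>v. v \<in> verts X \<Longrightarrow> (\<Sum>i\<in>I. h v i) = (if v = root X then 1 else 0)"
  shows "(\<Sum>i\<in>I. h (root X) i * l i ^ n) = real (loop_count X n)"
proof -
  have "(\<Sum>i\<in>I. h (root X) i * l i ^ n)
      = (\<Sum>i\<in>I. \<Sum>w\<in>walks X n. walk_weight X w * h (last w) i)"
    by (rule sum.cong) (simp_all add: eigenvector_walk_sum[OF r eig] mult.commute)
  also have "\<dots> = (\<Sum>w\<in>walks X n. walk_weight X w * (\<Sum>i\<in>I. h (last w) i))"
    by (subst sum.swap) (simp add: sum_distrib_left)
  also have "\<dots> = (\<Sum>w\<in>walks X n. if last w = root X then walk_weight X w else 0)"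
  proof (rule sum.cong)
    fix w assume "w \<in> walks X n"
    then have "last w \<in> verts X" by (cases w rule: rev_cases) (auto simp: walks_def)
    then show "walk_weight X w * (\<Sum>i\<in>I. h (last w) i)
        = (if last w = root X then walk_weight X w else 0)" by (simp add: unit)
  qed simp
  also have "\<dots> = (\<Sum>w\<in>root_seqs X n. walk_weight X w)"
  proof -
    have "{w \<in> walks X n. last w = root X} = root_seqs X n"
      by (auto simp: walks_def root_seqs_def)
    then show ?thesis using sum.inter_filter[OF finite_walks[OF fin, of n], of "walk_weight X" "\<lambda>w. last w = root X"]
      by simp
  qed
  also have "\<dots> = real (loop_count X n)"
    unfolding loop_count_def of_nat_sum of_nat_prod
    by (rule sum.cong) (auto simp: walk_weight_def root_seqs_def)
  finally show ?thesis .
qed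

section \<open>Measures determined by their moments\<close>

lemma finite_interpolation:
  fixes g :: "real \<Rightarrow> real"
  assumes "finite Y"
  shows "\<exists>p. \<forall>y\<in>Y. poly p y = g y"
  using assms
proof (induction Y)
  case (insert a Y)
  then obtain p where p: "\<forall>y\<in>Y. poly p y = g y" by blast
  define z where "z = (\<Prod>b\<in>Y. [:- b, 1:])"
  have z0: "poly z y = 0" if "y \<in> Y" for y
    using that insert.hyps(1) by (auto simp: z_def poly_prod)
  have za: "poly z a \<noteq> 0"
    using insert.hyps by (auto simp: z_def poly_prod)
  show ?case
    by (rule exI[of _ "p + smult ((g a - poly p a) / poly z a) z"]) (use p z0 za in auto)
qed simp

text \<open>
  Moments determine the integrals of polynomials. The square of the polynomial that vanishes at the
  prescribed atoms integrates to zero, so almost all mass sits at these atoms, where the indicator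
  of any set agrees with an interpolating polynomial.
\<close>

lemma finitely_supported_moment_determinacy:
  fixes \<mu> :: "real measure" and w x :: "'i \<Rightarrow> real"
  assumes "prob_space \<mu>" and sets: "sets \<mu> = sets borel" and F: "finite F"
    and int: "\<And>k. integrable \<mu> (\<lambda>y. y ^ k)"
    and mom: "\<And>k. (LINT y|\<mu>. y ^ k) = (\<Sum>i\<in>F. w i * x i ^ k)"
    and S: "S \<in> sets borel"
  shows "measure \<mu> S = (\<Sum>i\<in>F. w i * indicator S (x i))"
proof -
  interpret prob_space \<mu> by fact
  have ip: "integrable \<mu> (poly p)" for p
    unfolding poly_altdef by (intro Bochner_Integration.integrable_sum integrable_mult_right int)
  have lp: "(LINT y|\<mu>. poly p y) = (\<Sum>i\<in>F. w i * poly p (x i))" for p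
  proof -
    have "(LINT y|\<mu>. poly p y) = (\<Sum>k\<le>degree p. coeff p k * (\<Sum>i\<in>F. w i * x i ^ k))"
      unfolding poly_altdef by (simp add: int mom Bochner_Integration.integral_sum)
    also have "\<dots> = (\<Sum>i\<in>F. w i * poly p (x i))"
      unfolding poly_altdef sum_distrib_left by (subst sum.swap) (simp add: mult_ac)
    finally show ?thesis .
  qed
  define Y where "Y = x ` F"
  have Y: "finite Y" using F by (simp add: Y_def)
  define z where "z = (\<Prod>b\<in>Y. [:- b, 1:])"
  have z0: "poly z y = 0 \<longleftrightarrow> y \<in> Y" for y
    using Y by (auto simp: z_def poly_prod)
  have "(LINT y|\<mu>. poly (z * z) y) = 0"
    unfolding lp using z0 by (intro sum.neutral) (auto simp: Y_def)
  then have "AE y in \<mu>. poly (z * z) y = 0"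
    by (subst (asm) integral_nonneg_eq_0_iff_AE[OF ip]) simp_all
  then have AE_Y: "AE y in \<mu>. y \<in> Y" by eventually_elim (simp add: z0)
  obtain p where p: "\<forall>y\<in>Y. poly p y = indicator S y"
    using finite_interpolation[OF Y] by blast
  have "measure \<mu> S = (LINT y|\<mu>. indicator S y)" using S sets by simp
  also have "\<dots> = (LINT y|\<mu>. poly p y)"
    by (rule integral_cong_AE)
       (use AE_Y p S sets ip[of p] in \<open>auto elim!: eventually_mono intro: borel_measurable_integrable\<close>)
  also have "\<dots> = (\<Sum>i\<in>F. w i * indicator S (x i))"
    unfolding lp using p by (intro sum.cong) (auto simp: Y_def)
  finally show ?thesis .
qed

text \<open>
  The real measure is a definite description, so both existence and uniqueness are needed: the point
  masses themselves form a real measure, and every real measure has the same values by moment determinacy.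
\<close>

lemma real_measure_finite_support:
  fixes w x :: "'i \<Rightarrow> real"
  assumes F: "finite F" and w: "\<And>i. i \<in> F \<Longrightarrow> 0 \<le> w i" and x: "\<And>i. i \<in> F \<Longrightarrow> 0 \<le> x i"
    and total: "(\<Sum>i\<in>F. w i) = 1"
    and mom: "\<And>k. (\<Sum>i\<in>F. w i * x i ^ k) = real (loop_count X (2 * k))"
    and S: "S \<in> sets borel"
  shows "measure (real_measure X) S = (\<Sum>i\<in>F. w i * indicator S (x i))"
proof -
  define P where "P = point_measure F (\<lambda>i. ennreal (w i))"
  define \<nu> where "\<nu> = distr P borel x"
  have meas: "x \<in> measurable P borel" by (simp add: P_def)
  have P: "prob_space P"
    by (rule prob_spaceI) (use F w total in \<open>simp add: P_def emeasure_point_measure_finite space_point_measure\<close>)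
  have "is_real_measure X \<nu>"
    unfolding is_real_measure_def
  proof (intro conjI allI)
    show "prob_space \<nu>" unfolding \<nu>_def by (rule prob_space.prob_space_distr[OF P meas])
    show "sets \<nu> = sets borel" by (simp add: \<nu>_def)
    show "AE y in \<nu>. 0 \<le> y" unfolding \<nu>_def
    proof (subst AE_distr_iff[OF meas])
      show "AE i in P. 0 \<le> x i" unfolding P_def using x by (simp add: AE_point_measure)
    qed simp
    fix k :: nat
    show "integrable \<nu> (\<lambda>y. y ^ k)" unfolding \<nu>_def
      by (subst integrable_distr_eq[OF meas]) (use F in \<open>auto simp: P_def integrable_point_measure_finite\<close>)
    show "(LINT y|\<nu>. y ^ k) = real (loop_count X (2 * k))" unfolding \<nu>_def
      by (subst integral_distr[OF meas])
         (use F w mom in \<open>auto simp: P_def lebesgue_integral_point_measure_finite\<close>)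
  qed
  moreover have val: "measure \<mu> A = (\<Sum>i\<in>F. w i * indicator A (x i))"
    if "is_real_measure X \<mu>" "A \<in> sets borel" for \<mu> A
    using that F mom by (intro finitely_supported_moment_determinacy) (auto simp: is_real_measure_def)
  moreover have "\<mu> = \<mu>'" if \<mu>: "is_real_measure X \<mu>" "is_real_measure X \<mu>'" for \<mu> \<mu>'
  proof (rule measure_eqI)
    have ps: "prob_space \<mu>" "prob_space \<mu>'" and s: "sets \<mu> = sets borel" "sets \<mu>' = sets borel"
      using \<mu> by (auto simp: is_real_measure_def)
    show "sets \<mu> = sets \<mu>'" using s by simp
    fix A assume "A \<in> sets \<mu>"
    then have "measure \<mu> A = measure \<mu>' A" using val[OF \<mu>(1)] val[OF \<mu>(2)] s by simp
    then show "emeasure \<mu> A = emeasure \<mu>' A"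
      using ps by (simp add: finite_measure.emeasure_eq_measure prob_space.finite_measure)
  qed
  ultimately have "real_measure X = \<nu>" "is_real_measure X \<nu>"
    unfolding real_measure_def by blast+
  then show ?thesis using val S by simp
qed

section \<open>The circular measure of a spectral decomposition\<close>

abbreviation roots_of_unity :: "nat \<Rightarrow> complex set" where
  "roots_of_unity n \<equiv> {q. q ^ n = 1}"

lemma norm_root_of_unity:
  fixes q :: complex
  assumes "q ^ m = 1" "0 < m"
  shows "norm q = 1"
  using assms power_eq_1_iff[of q m] by simp

lemma inverse_eq_cnj: "norm q = 1 \<Longrightarrow> inverse q = cnj q"
  by (simp add: inverse_complex_def complex_eq_iff flip: cmod_power2)

text \<open>
  Values at \<open>S\<close> of the four Dirac masses by which the circular measure replaces an atom. It is
  invariant under \<open>q \<mapsto> 1/q\<close> and \<open>q \<mapsto> -q\<close>, so it is the same for every solution that \<open>circ_root\<close> might pick.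
\<close>

definition orbit_indicator :: "complex set \<Rightarrow> complex \<Rightarrow> real" where
  "orbit_indicator S q =
    indicator S q + indicator S (inverse q) + indicator S (- q) + indicator S (- inverse q)"

lemma orbit_indicator_circ_root:
  assumes "q \<noteq> 0" "(q + inverse q)\<^sup>2 = of_real x"
  shows "orbit_indicator S (circ_root x) = orbit_indicator S q"
proof -
  define c where "c = circ_root x"
  have "c \<noteq> 0 \<and> (c + inverse c)\<^sup>2 = of_real x"
    unfolding c_def circ_root_def by (rule someI[of _ q]) (use assms in simp)
  then have c: "c \<noteq> 0" "(c + inverse c)\<^sup>2 = (q + inverse q)\<^sup>2" using assms by auto
  \<comment> \<open>The four solutions of the quartic equation are the four points of the orbit.\<close>
  have "(c - q) * (c - inverse q) * (c + q) * (c + inverse q)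
      = c\<^sup>2 * ((c + inverse c)\<^sup>2 - (q + inverse q)\<^sup>2)"
    using c(1) assms(1) by (simp add: field_simps power2_eq_square)
  then have "c = q \<or> c = inverse q \<or> c = - q \<or> c = - inverse q"
    using c(2) by (auto simp: add_eq_0_iff2)
  then show ?thesis
    unfolding c_def[symmetric] by (auto simp: orbit_indicator_def)
qed

text \<open>
  The real measure is the image of \<open>w\<close> under \<open>q \<mapsto> (2 Re q)\<^sup>2\<close>. Grouping the points \<open>q\<close> by their image
  turns the sum over the atoms of the real measure into a sum over \<open>F\<close>, and by symmetry of \<open>w\<close> the
  four Dirac masses contribute equally.
\<close>

lemma circular_measure_from_weights:
  fixes w :: "complex \<Rightarrow> real"
  assumes F: "finite F" and unit: "\<And>q. q \<in> F \<Longrightarrow> norm q = 1"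
    and closed: "\<And>q. q \<in> F \<Longrightarrow> - q \<in> F" "\<And>q. q \<in> F \<Longrightarrow> inverse q \<in> F"
    and sym: "\<And>q. q \<in> F \<Longrightarrow> w (- q) = w q" "\<And>q. q \<in> F \<Longrightarrow> w (inverse q) = w q"
    and nonneg: "\<And>q. q \<in> F \<Longrightarrow> 0 \<le> w q" and total: "(\<Sum>q\<in>F. w q) = 1"
    and mom: "\<And>k. (\<Sum>q\<in>F. w q * (2 * Re q) ^ (2 * k)) = real (loop_count X (2 * k))"
  shows "circular_measure X S = (\<Sum>q\<in>F. w q * indicator S q)"
proof -
  define x where "x q = (2 * Re q)\<^sup>2" for q
  have meas: "measure (real_measure X) A = (\<Sum>q\<in>F. w q * indicator A (x q))"
    if "A \<in> sets borel" for A
  proof (rule real_measure_finite_support)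
    show "(\<Sum>q\<in>F. w q * x q ^ k) = real (loop_count X (2 * k))" for k
      unfolding mom[symmetric] by (simp only: x_def power_mult)
  qed (use that F nonneg total in \<open>auto simp: x_def\<close>)
  have root: "orbit_indicator S (circ_root (x q)) = orbit_indicator S q" if "q \<in> F" for q
  proof (rule orbit_indicator_circ_root)
    show "q \<noteq> 0" using unit[OF that] by auto
    have "inverse q = cnj q" using unit[OF that] by (rule inverse_eq_cnj)
    then show "(q + inverse q)\<^sup>2 = of_real (x q)" by (simp add: x_def complex_add_cnj)
  qed
  have "circular_measure X S = 1/4 * (\<Sum>y | measure (real_measure X) {y} \<noteq> 0.
      measure (real_measure X) {y} * orbit_indicator S (circ_root y))"
    by (simp add: circular_measure_def orbit_indicator_def Let_def)
  also have "(\<Sum>y | measure (real_measure X) {y} \<noteq> 0.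
      measure (real_measure X) {y} * orbit_indicator S (circ_root y))
    = (\<Sum>y\<in>x ` F. measure (real_measure X) {y} * orbit_indicator S (circ_root y))"
  proof (rule sum.mono_neutral_left)
    show "{y. measure (real_measure X) {y} \<noteq> 0} \<subseteq> x ` F"
    proof
      fix y assume "y \<in> {y. measure (real_measure X) {y} \<noteq> 0}"
      then have "(\<Sum>q\<in>F. w q * indicator {y} (x q)) \<noteq> 0" using meas[of "{y}"] by simp
      then obtain q where "q \<in> F" "w q * indicator {y} (x q) \<noteq> 0" by (rule sum.not_neutral_contains_not_neutral)
      then show "y \<in> x ` F" by (auto simp: indicator_def split: if_splits)
    qed
  qed (use F in auto)
  also have "\<dots> = (\<Sum>y\<in>x ` F. \<Sum>q | q \<in> F \<and> x q = y. w q * orbit_indicator S q)"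
  proof (rule sum.cong)
    fix y assume "y \<in> x ` F"
    have "measure (real_measure X) {y} = (\<Sum>q | q \<in> F \<and> x q = y. w q)"
      unfolding meas[OF borel_singleton[OF sets.empty_sets]] by (subst sum.inter_filter[OF F]) (auto intro!: sum.cong simp: indicator_def)
    then show "measure (real_measure X) {y} * orbit_indicator S (circ_root y)
        = (\<Sum>q | q \<in> F \<and> x q = y. w q * orbit_indicator S q)"
      using root by (auto simp: sum_distrib_right intro!: sum.cong)
  qed simp
  also have "\<dots> = (\<Sum>q\<in>F. w q * orbit_indicator S q)"
    by (rule sum.group) (use F in auto)
  also have "\<dots> = 4 * (\<Sum>q\<in>F. w q * indicator S q)"
  proof -
    have reindex: "(\<Sum>q\<in>F. w q * indicator S (t q)) = (\<Sum>q\<in>F. w q * indicator S q)"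
      if "\<And>q. q \<in> F \<Longrightarrow> t q \<in> F" "\<And>q. t (t q) = q" "\<And>q. q \<in> F \<Longrightarrow> w (t q) = w q" for t
      by (rule sum.reindex_bij_witness[of _ t t]) (use that in auto)
    have "(\<Sum>q\<in>F. w q * indicator S (inverse q)) = (\<Sum>q\<in>F. w q * indicator S q)"
      "(\<Sum>q\<in>F. w q * indicator S (- q)) = (\<Sum>q\<in>F. w q * indicator S q)"
      "(\<Sum>q\<in>F. w q * indicator S (- inverse q)) = (\<Sum>q\<in>F. w q * indicator S q)"
      by (rule reindex; use closed sym in simp)+
    then show ?thesis by (simp add: orbit_indicator_def distrib_left sum.distrib)
  qed
  finally show ?thesis by simp
qed

text \<open>
  The function \<open>h\<close> is allowed to mix several eigenvectors at the same \<open>q\<close>, as is needed when an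
  eigenvalue arises from two summands of the measure.
\<close>

lemma circular_measure_from_eigenvectors:
  fixes h :: "'v \<Rightarrow> complex \<Rightarrow> real"
  assumes X: "finite_rooted_bipartite X" and m: "0 < m" "even m"
    and eig: "\<And>q v. q ^ m = 1 \<Longrightarrow> v \<in> verts X \<Longrightarrow>
      nbr_sum (verts X) (edges X) (\<lambda>u. h u q) v = 2 * Re q * h v q"
    and unit: "\<And>v. v \<in> verts X \<Longrightarrow> (\<Sum>q\<in>roots_of_unity m. h v q) = (if v = root X then 1 else 0)"
    and w: "\<And>q. h (root X) q = w q"
    and nonneg: "\<And>q. q ^ m = 1 \<Longrightarrow> 0 \<le> w q"
    and sym: "\<And>q. q ^ m = 1 \<Longrightarrow> w (- q) = w q" "\<And>q. q ^ m = 1 \<Longrightarrow> w (inverse q) = w q"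
  shows "circular_measure X S = (\<Sum>q\<in>roots_of_unity m. w q * indicator S q)"
proof (rule circular_measure_from_weights)
  have V: "finite (verts X)" "root X \<in> verts X" using X by (auto simp: finite_rooted_bipartite_def)
  show "finite (roots_of_unity m)" using m by (intro finite_roots_unity) simp
  show "norm q = 1" if "q \<in> roots_of_unity m" for q
    using that m by (auto intro: norm_root_of_unity)
  show "(\<Sum>q\<in>roots_of_unity m. w q) = 1"
    using unit[OF V(2)] w by simp
  show "(\<Sum>q\<in>roots_of_unity m. w q * (2 * Re q) ^ (2 * k)) = real (loop_count X (2 * k))" for k
    using loop_count_spectral[OF V, of "roots_of_unity m" h "\<lambda>q. 2 * Re q"] eig unit w by simp
qed (use m nonneg sym in \<open>auto simp: power_inverse\<close>)

section \<open>Uniform measures on roots of unity\<close>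

text \<open>
  On the unit circle this is \<open>q\<^sup>j + q\<^sup>-\<^sup>j\<close>; in particular \<open>tr 1 q\<close> is the adjacency eigenvalue that
  belongs to \<open>q\<close>. Real values make linear arithmetic available.
\<close>

definition tr :: "nat \<Rightarrow> complex \<Rightarrow> real" where
  "tr j q = 2 * Re (q ^ j)"

lemma tr_0 [simp]: "tr 0 q = 2" by (simp add: tr_def)

lemma tr_mult:
  assumes "norm q = 1" "j \<le> k"
  shows "tr j q * tr k q = tr (k + j) q + tr (k - j) q"
proof -
  have "q ^ j * cnj (q ^ j) = 1"
    using assms(1) by (simp only: complex_mult_cnj cmod_power2[symmetric] norm_power) simp
  moreover have "q ^ k = q ^ (k - j) * q ^ j" using assms(2) by (simp flip: power_add)
  ultimately have "q ^ (k - j) = q ^ k * cnj (q ^ j)" by (simp add: mult.assoc)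
  then show ?thesis by (simp add: tr_def power_add algebra_simps del: complex_cnj_power)
qed

lemma tr_mult_abs:
  assumes "norm q = 1"
  shows "tr i q * tr j q = tr (i + j) q + tr (if i \<le> j then j - i else i - j) q"
  using tr_mult[OF assms, of i j] tr_mult[OF assms, of j i] by (cases "i \<le> j") (simp_all add: add.commute mult.commute)

text \<open>
  Numerical instances, used as rewrite rules in the eigenvector equations of the exceptional graphs.
\<close>

lemma tr_1_mult:
  assumes "norm q = 1"
  shows "tr 1 q * tr 1 q = tr 2 q + 2" "tr 1 q * tr 2 q = tr 3 q + tr 1 q"
    "tr 1 q * tr 3 q = tr 4 q + tr 2 q" "tr 1 q * tr 4 q = tr 5 q + tr 3 q"
    "tr 1 q * tr 5 q = tr 6 q + tr 4 q" "tr 1 q * tr 6 q = tr 7 q + tr 5 q"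
    "tr 1 q * tr 7 q = tr 8 q + tr 6 q" "tr 1 q * tr 8 q = tr 9 q + tr 7 q"
  by (subst tr_mult[OF assms]; simp add: eval_nat_numeral)+

lemma tr_minus [simp]: "even j \<Longrightarrow> tr j (- q) = tr j q"
  by (simp add: tr_def)

lemma tr_inverse [simp]: "norm q = 1 \<Longrightarrow> tr j (inverse q) = tr j q"
  by (simp add: tr_def inverse_eq_cnj flip: complex_cnj_power)

text \<open>
  If \<open>q\<^sup>j\<^sup>+\<^sup>k\<close> is the sign \<open>e\<close>, then \<open>q\<^sup>j\<close> is \<open>e\<close> times the complex conjugate of \<open>q\<^sup>k\<close>. This is how the
  order of \<open>q\<close> enters the eigenvector equation at the far end of a graph.
\<close>

lemma tr_reflect:
  assumes "norm q = 1" "q ^ (j + k) = of_real e" "e\<^sup>2 = 1"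
  shows "tr j q = e * tr k q"
proof -
  have "q ^ k * cnj (q ^ k) = 1"
    using assms(1) by (simp only: complex_mult_cnj cmod_power2[symmetric] norm_power) simp
  then have "q ^ j = q ^ (j + k) * cnj (q ^ k)" by (simp add: power_add mult.assoc)
  then have "q ^ j = of_real e * cnj (q ^ k)" using assms(2) by simp
  then show ?thesis by (simp add: tr_def del: complex_cnj_power)
qed

lemma tr_reflect_1: "norm q = 1 \<Longrightarrow> q ^ (j + k) = 1 \<Longrightarrow> tr j q = tr k q"
  using tr_reflect[of q j k 1] by simp

lemma tr_period: "q ^ k = 1 \<Longrightarrow> tr (j + k) q = tr j q"
  by (simp add: tr_def power_add)

definition unif_weight :: "nat \<Rightarrow> complex \<Rightarrow> real" where
  "unif_weight n q = (if q ^ (2 * n) = 1 then 1 / (2 * n) else 0)"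

definition odd_weight :: "nat \<Rightarrow> complex \<Rightarrow> real" where
  "odd_weight n q = (if q ^ (2 * n) = - 1 then 1 / (2 * n) else 0)"

lemma odd_weight_eq: "n \<ge> 1 \<Longrightarrow> odd_weight n q = 2 * unif_weight (2 * n) q - unif_weight n q"
proof -
  assume n: "n \<ge> 1"
  have "q ^ (2 * (2 * n)) = (q ^ (2 * n))\<^sup>2" by (simp add: power_mult [symmetric] mult.commute)
  then show ?thesis
    using n by (auto simp: odd_weight_def unif_weight_def power2_eq_1_iff)
qed

lemma unif_weight_nonneg: "0 \<le> unif_weight n q" by (simp add: unif_weight_def)
lemma odd_weight_nonneg: "0 \<le> odd_weight n q" by (simp add: odd_weight_def)

lemma weight_symmetric [simp]:
  "unif_weight n (- q) = unif_weight n q" "odd_weight n (- q) = odd_weight n q"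
  "unif_weight n (inverse q) = unif_weight n q" "odd_weight n (inverse q) = odd_weight n q"
  by (simp_all add: unif_weight_def odd_weight_def power_inverse)
     (metis inverse_inverse_eq inverse_minus_eq inverse_1)+

text \<open>
  Multiplication by a primitive root of unity permutes the roots and multiplies the sum by a factor
  different from \<open>1\<close> unless \<open>m\<close> divides \<open>j\<close>.
\<close>

lemma sum_powers_roots_of_unity:
  assumes m: "m \<ge> 1"
  shows "(\<Sum>q\<in>roots_of_unity m. q ^ j) = (if m dvd j then of_nat m else 0)"
proof (cases "m dvd j")
  case True
  then have "q ^ j = 1" if "q ^ m = 1" for q :: complex using that by (auto simp: power_mult)
  then show ?thesis using True card_roots_unity_eq[of m] m by simp
next
  case False
  define z where "z = cis (2 * pi / m)"
  have zm: "z ^ m = 1"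
  proof -
    have "real m * (2 * pi / real m) = 2 * pi" using m by simp
    then show ?thesis by (simp only: z_def Complex.DeMoivre cis_2pi)
  qed
  have "z ^ j \<noteq> 1"
  proof
    assume "z ^ j = 1"
    then have "cos (j * (2 * pi / m)) = 1" unfolding z_def Complex.DeMoivre by (simp add: complex_eq_iff)
    then obtain k :: int where "j * (2 * pi / m) = of_int k * (2 * pi)"
      unfolding cos_one_2pi_int by (auto simp: mult_ac)
    then have "real j = of_int k * real m" using m by (simp add: field_simps)
    then have "int j = k * int m" by (metis of_int_eq_iff of_int_mult of_int_of_nat_eq)
    then have "int m dvd int j" by simp
    with False show False by simp
  qed
  have z0: "z \<noteq> 0" by (simp add: z_def)
  have "(\<Sum>q\<in>roots_of_unity m. q ^ j) = (\<Sum>q\<in>roots_of_unity m. (z * q) ^ j)"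
    by (rule sum.reindex_bij_witness[of _ "\<lambda>q. z * q" "\<lambda>q. q / z"])
       (use zm z0 in \<open>auto simp: power_mult_distrib power_divide\<close>)
  also have "\<dots> = z ^ j * (\<Sum>q\<in>roots_of_unity m. q ^ j)"
    by (simp add: power_mult_distrib sum_distrib_left)
  finally show ?thesis using \<open>z ^ j \<noteq> 1\<close> False by simp
qed

text \<open>
  All measures in one formula are summed over the same group of roots of unity, of any order \<open>m\<close> that is
  a multiple of the orders involved.
\<close>

lemma sum_unif_weight:
  assumes "1 \<le> n" "0 < m" "2 * n dvd m"
  shows "(\<Sum>q\<in>roots_of_unity m. unif_weight n q * g q)
      = (\<Sum>q\<in>roots_of_unity (2 * n). g q) / (2 * n)"
proof -
  have "q ^ m = 1" if "q ^ (2 * n) = 1" for q :: complex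
    using that assms(3) by (metis dvdE power_mult power_one)
  then have "roots_of_unity (2 * n) = {q \<in> roots_of_unity m. q ^ (2 * n) = 1}" by auto
  then have "(\<Sum>q\<in>roots_of_unity (2 * n). g q) / (2 * n)
      = (\<Sum>q\<in>roots_of_unity m. if q ^ (2 * n) = 1 then g q / (2 * n) else 0)"
    using assms by (subst sum.inter_filter[symmetric]) (auto simp: sum_divide_distrib intro!: finite_roots_unity)
  also have "\<dots> = (\<Sum>q\<in>roots_of_unity m. unif_weight n q * g q)"
    by (rule sum.cong) (simp_all add: unif_weight_def)
  finally show ?thesis by simp
qed

lemma sum_unif_tr:
  assumes "1 \<le> n" "0 < m" "2 * n dvd m"
  shows "(\<Sum>q\<in>roots_of_unity m. unif_weight n q * tr j q) = (if 2 * n dvd j then 2 else 0)"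
proof -
  have "(\<Sum>q\<in>roots_of_unity (2 * n). tr j q) = 2 * Re (\<Sum>q\<in>roots_of_unity (2 * n). q ^ j)"
    by (simp add: tr_def sum_distrib_left)
  then show ?thesis
    unfolding sum_unif_weight[OF assms] using sum_powers_roots_of_unity[of "2 * n" j] assms(1) by simp
qed

lemma sum_odd_tr:
  assumes "1 \<le> n" "0 < m" "4 * n dvd m"
  shows "(\<Sum>q\<in>roots_of_unity m. odd_weight n q * tr j q)
    = (if 4 * n dvd j then 2 else if 2 * n dvd j then - 2 else 0)"
proof -
  have 4: "4 * n = 2 * n * 2" by simp
  then have "2 * n dvd m" using assms(3) by (metis dvd_mult_left)
  then have "(\<Sum>q\<in>roots_of_unity m. odd_weight n q * tr j q)
      = 2 * (if 2 * (2 * n) dvd j then 2 else 0) - (if 2 * n dvd j then 2 else 0)"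
    using assms by (simp only: odd_weight_eq left_diff_distrib sum_subtractf mult.assoc
      sum_distrib_left[symmetric]) (simp add: sum_unif_tr)
  moreover have "4 * n dvd j \<Longrightarrow> 2 * n dvd j" unfolding 4 by (rule dvd_mult_left)
  ultimately show ?thesis by (simp add: mult.assoc[symmetric])
qed

lemma sum_unif_tr_tr:
  assumes "1 \<le> n" "0 < m" "2 * n dvd m"
  shows "(\<Sum>q\<in>roots_of_unity m. unif_weight n q * (tr i q * tr j q))
    = (if 2 * n dvd i + j then 2 else 0) + (if 2 * n dvd (if i \<le> j then j - i else i - j) then 2 else 0)"
proof -
  have "(\<Sum>q\<in>roots_of_unity m. unif_weight n q * (tr i q * tr j q))
      = (\<Sum>q\<in>roots_of_unity m. unif_weight n q * tr (i + j) q
        + unif_weight n q * tr (if i \<le> j then j - i else i - j) q)"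
    by (rule sum.cong[OF refl], subst tr_mult_abs) (use norm_root_of_unity assms(2) in \<open>auto simp: distrib_left\<close>)
  then show ?thesis unfolding sum.distrib sum_unif_tr[OF assms] .
qed

lemma sum_odd_tr_tr:
  assumes "1 \<le> n" "0 < m" "4 * n dvd m"
  shows "(\<Sum>q\<in>roots_of_unity m. odd_weight n q * (tr i q * tr j q))
    = (\<Sum>q\<in>roots_of_unity m. odd_weight n q * tr (i + j) q)
      + (\<Sum>q\<in>roots_of_unity m. odd_weight n q * tr (if i \<le> j then j - i else i - j) q)"
  unfolding sum.distrib[symmetric]
  by (rule sum.cong[OF refl], subst tr_mult_abs) (use norm_root_of_unity assms(2) in \<open>auto simp: distrib_left\<close>)

lemma set_lebesgue_integral_pmf_of_set:
  fixes l :: "'a \<Rightarrow> real"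
  assumes "finite A" "A \<noteq> {}"
  shows "(LINT q:S|measure_pmf (pmf_of_set A). l q) = (\<Sum>q\<in>A. l q * indicator S q / card A)"
  unfolding sum_divide_distrib[symmetric]
  using assms by (simp add: set_lebesgue_integral_def integral_pmf_of_set mult.commute)

lemma with_density_unif:
  assumes "1 \<le> n" "0 < m" "2 * n dvd m"
  shows "with_density l (d_unif n) S
    = (\<Sum>q\<in>roots_of_unity m. unif_weight n q * l q * indicator S q)"
proof -
  have "with_density l (d_unif n) S = (\<Sum>q\<in>roots_of_unity (2 * n). l q * indicator S q / (2 * n))"
    unfolding with_density_def d_unif_def
    by (subst set_lebesgue_integral_pmf_of_set)
       (use assms card_roots_unity_eq[of "2 * n"] in \<open>auto intro!: finite_roots_unity exI[of _ 1]\<close>)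
  then show ?thesis
    unfolding mult.assoc sum_unif_weight[OF assms] by (simp add: sum_divide_distrib)
qed

lemma with_density_odd:
  assumes "1 \<le> n" "0 < m" "4 * n dvd m"
  shows "with_density l (d_odd n) S
    = (\<Sum>q\<in>roots_of_unity m. odd_weight n q * l q * indicator S q)"
proof -
  let ?M = "{q :: complex. q ^ (2 * n) = - 1}"
  have sub: "q ^ m = 1" if "q ^ (2 * n) = -1" for q :: complex
  proof -
    obtain k where "m = 4 * n * k" using assms(3) by (elim dvdE)
    then have "m = 2 * n * 2 * k" by simp
    then have "q ^ m = ((q ^ (2 * n))\<^sup>2) ^ k" by (simp only: power_mult[symmetric] mult_ac)
    then show ?thesis unfolding that by simp
  qed
  have fin: "finite ?M"
    by (rule finite_subset[OF _ finite_roots_unity[of m]]) (use sub assms in auto)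
  have "exp (\<i> * of_real pi / of_nat (2 * n)) \<in> ?M" using exp_pi_power_2n[OF assms(1)] by blast
  then have ne: "?M \<noteq> {}" by blast
  have card: "card ?M = 2 * n"
  proof -
    obtain z where z: "z ^ (2 * n) = (-1 :: complex)" using ne by blast
    then have z0: "z \<noteq> 0" using assms(1) by (auto simp: power_0_left)
    have "bij_betw (\<lambda>q. z * q) (roots_of_unity (2 * n)) ?M"
      by (rule bij_betw_byWitness[of _ "\<lambda>q. q / z"])
         (use z z0 in \<open>auto simp: power_mult_distrib power_divide\<close>)
    then show ?thesis using card_roots_unity_eq[of "2 * n"] assms(1) by (simp add: bij_betw_same_card[symmetric])
  qed
  have "with_density l (d_odd n) S = (\<Sum>q\<in>?M. l q * indicator S q / (2 * n))"
    unfolding with_density_def d_odd_def odd_powers_eq[OF assms(1)]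
      set_lebesgue_integral_pmf_of_set[OF fin ne] card by simp
  also have "?M = {q \<in> roots_of_unity m. q ^ (2 * n) = -1}" using sub by auto
  also have "(\<Sum>q\<in>\<dots>. l q * indicator S q / (2 * n))
      = (\<Sum>q\<in>roots_of_unity m. odd_weight n q * l q * indicator S q)"
    using assms by (subst sum.inter_filter) (auto intro!: finite_roots_unity sum.cong simp: odd_weight_def)
  finally show ?thesis .
qed

lemma measure_eq_with_density:
  "measure (d_unif n) S = with_density (\<lambda>_. 1) (d_unif n) S"
  "measure (d_odd n) S = with_density (\<lambda>_. 1) (d_odd n) S"
  by (simp_all add: with_density_def d_unif_def d_odd_def set_lebesgue_integral_def)

lemma densities_tr:
  "alpha q = 1 - tr 2 q / 2" "beta q = 1 - tr 4 q / 2" "gamma q = 1 - tr 6 q / 2"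
  by (simp_all add: alpha_def beta_def gamma_def tr_def)

lemma tr_le_2: "norm q = 1 \<Longrightarrow> tr j q \<le> 2"
  using complex_Re_le_cmod[of "q ^ j"] by (simp add: tr_def norm_power)

text \<open>
  The usual special case: one eigenvector for each point of the support, normalised to have root
  entry \<open>1\<close>. Outside the support of \<open>w\<close> the eigenvector equation is void.
\<close>

lemma circular_measure_from_eigenfunctions:
  fixes f :: "'v \<Rightarrow> complex \<Rightarrow> real"
  assumes X: "finite_rooted_bipartite X" and m: "0 < m" "even m"
    and eig: "\<And>q v. q ^ m = 1 \<Longrightarrow> norm q = 1 \<Longrightarrow> w q \<noteq> 0 \<Longrightarrow> v \<in> verts X \<Longrightarrow>
      nbr_sum (verts X) (edges X) (\<lambda>u. f u q) v = tr 1 q * f v q"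
    and unit: "\<And>v. v \<in> verts X \<Longrightarrow>
      (\<Sum>q\<in>roots_of_unity m. w q * f v q) = (if v = root X then 1 else 0)"
    and root: "\<And>q. f (root X) q = 1"
    and nonneg: "\<And>q. q ^ m = 1 \<Longrightarrow> norm q = 1 \<Longrightarrow> 0 \<le> w q"
    and sym: "\<And>q. norm q = 1 \<Longrightarrow> w (- q) = w q" "\<And>q. norm q = 1 \<Longrightarrow> w (inverse q) = w q"
  shows "circular_measure X S = (\<Sum>q\<in>roots_of_unity m. w q * indicator S q)"
proof (rule circular_measure_from_eigenvectors[OF X m, where h = "\<lambda>v q. w q * f v q"])
  fix q :: complex and v assume q: "q ^ m = 1" and v: "v \<in> verts X"
  have "nbr_sum (verts X) (edges X) (\<lambda>u. w q * f u q) v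
      = w q * nbr_sum (verts X) (edges X) (\<lambda>u. f u q) v"
    by (simp add: nbr_sum_def sum_distrib_left mult_ac)
  also have "\<dots> = 2 * Re q * (w q * f v q)"
    using eig[OF q norm_root_of_unity[OF q m(1)] _ v] by (cases "w q = 0") (simp_all add: tr_def)
  finally show "nbr_sum (verts X) (edges X) (\<lambda>u. w q * f u q) v = 2 * Re q * (w q * f v q)" .
qed (use unit root nonneg sym norm_root_of_unity[OF _ m(1)] in auto)

section \<open>Adjacency sums\<close>

lemma nbr_sum_scale: "nbr_sum V E (\<lambda>u. c * g u) v = c * nbr_sum V E g v"
  by (simp add: nbr_sum_def sum_distrib_left mult_ac)

lemma nbr_sum_add: "nbr_sum V E (\<lambda>u. f u + g u) v = nbr_sum V E f v + nbr_sum V E g v"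
  by (simp add: nbr_sum_def sum.distrib distrib_left)

lemma nbr_sum_union: "nbr_sum V (E + E') g v = nbr_sum V E g v + nbr_sum V E' g v"
  by (simp add: nbr_sum_def sum.distrib distrib_right)

lemma nbr_sum_empty: "nbr_sum V {#} g v = 0"
  by (simp add: nbr_sum_def)

lemma nbr_sum_add_edge:
  assumes "finite V" "a \<in> V" "b \<in> V" "a \<noteq> b"
  shows "nbr_sum V (add_mset {a, b} E) g v
    = (if v = a then g b else 0) + (if v = b then g a else 0) + nbr_sum V E g v"
proof -
  have "real (count (add_mset {a, b} E) {v, u}) * g u = (if u = b then if v = a then g b else 0 else 0)
      + (if u = a then if v = b then g a else 0 else 0) + real (count E {v, u}) * g u" for u
    using assms(4) by (auto simp: doubleton_eq_iff distrib_right)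
  then show ?thesis using assms by (simp add: nbr_sum_def sum.distrib)
qed

lemma nbr_sum_edge_family:
  assumes "finite V" "finite J" "\<And>i. i \<in> J \<Longrightarrow> s i \<in> V \<and> t i \<in> V \<and> s i \<noteq> t i"
  shows "nbr_sum V {# {s i, t i}. i \<in># mset_set J #} g v
    = (\<Sum>i\<in>J. if v = s i then g (t i) else 0) + (\<Sum>i\<in>J. if v = t i then g (s i) else 0)"
  using assms(2,3)
  by (induction J rule: finite_induct) (simp_all add: nbr_sum_empty nbr_sum_add_edge[OF assms(1)])

lemma nbr_sum_path:
  assumes "finite V" "\<And>i. a \<le> i \<Longrightarrow> i < b \<Longrightarrow> i \<in> V \<and> Suc i \<in> V"
  shows "nbr_sum V (path_edges a b) g v
    = (if a \<le> v \<and> v < b then g (Suc v) else 0) + (if a < v \<and> v \<le> b then g (v - 1) else 0)"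
proof -
  have "(\<Sum>i\<in>{a..<b}. if v = Suc i then g i else 0) = (\<Sum>i\<in>{a..<b}. if i = v - 1 then if a < v then g (v - 1) else 0 else 0)"
    by (rule sum.cong) auto
  also have "\<dots> = (if a < v \<and> v \<le> b then g (v - 1) else 0)" by auto
  finally show ?thesis
    using assms by (subst nbr_sum_edge_family) auto
qed

section \<open>Paths, forks and cycles\<close>

text \<open>
  Chebyshev polynomials of the second kind in the scaling \<open>x = q + 1/q\<close>.
\<close>

fun cheb :: "nat \<Rightarrow> real \<Rightarrow> real" where
  "cheb 0 x = 1"
| "cheb (Suc 0) x = x"
| "cheb (Suc (Suc k)) x = x * cheb (Suc k) x - cheb k x"

text \<open>
  The eigenvector equation at an inner vertex of a path whose vertices are numbered from \<open>1\<close>. At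
  \<open>v = 1\<close> there is no preceding vertex.
\<close>

lemma cheb_rec:
  assumes "1 \<le> v"
  shows "x * cheb (v - 1) x = cheb v x + (if v = 1 then 0 else cheb (v - 2) x)"
proof (cases "v = 1")
  case False
  with assms obtain k where "v = Suc (Suc k)" by (metis One_nat_def not0_implies_Suc not_one_le_zero)
  then show ?thesis by simp
qed simp

text \<open>
  On the unit circle \<open>alpha q = - (q - 1/q)\<^sup>2 / 2\<close>, and \<open>cheb k (q + 1/q)\<close> is
  \<open>(q\<^sup>k\<^sup>+\<^sup>1 - q\<^sup>-\<^sup>k\<^sup>-\<^sup>1) / (q - 1/q)\<close> whenever \<open>q\<close> and \<open>1/q\<close> differ. The density therefore cancels the
  denominator. The induction along the recursion covers \<open>q = \<plusminus>1\<close> as well.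
\<close>

lemma alpha_cheb:
  assumes "norm q = 1"
  shows "alpha q * cheb k (tr 1 q) = (tr k q - tr (k + 2) q) / 2"
proof (induction k "tr 1 q" rule: cheb.induct)
  case 2
  then show ?case using tr_mult[OF assms, of 1 2] by (simp add: densities_tr algebra_simps eval_nat_numeral)
next
  case (3 k)
  have "alpha q * cheb (Suc (Suc k)) (tr 1 q)
      = tr 1 q * (alpha q * cheb (Suc k) (tr 1 q)) - alpha q * cheb k (tr 1 q)"
    by (simp add: algebra_simps)
  also have "\<dots> = tr 1 q * ((tr (Suc k) q - tr (Suc k + 2) q) / 2) - (tr k q - tr (k + 2) q) / 2"
    by (simp only: 3)
  finally have "alpha q * cheb (Suc (Suc k)) (tr 1 q)
      = tr 1 q * ((tr (Suc k) q - tr (Suc k + 2) q) / 2) - (tr k q - tr (k + 2) q) / 2" .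
  then show ?case
    using tr_mult[OF assms, of 1 "Suc k"] tr_mult[OF assms, of 1 "Suc k + 2"]
    by (simp add: algebra_simps add_divide_distrib diff_divide_distrib del: cheb.simps)
qed (simp add: densities_tr diff_divide_distrib numeral_2_eq_2)

lemma cheb_diff:
  assumes "norm q = 1"
  shows "cheb (k + 2) (tr 1 q) - cheb k (tr 1 q) = tr (k + 2) q"
proof (induction k "tr 1 q" rule: cheb.induct)
  case 1
  then show ?case using tr_mult[OF assms, of 1 1] by (simp add: eval_nat_numeral)
next
  case 2
  then show ?case using tr_mult[OF assms, of 1 1] tr_mult[OF assms, of 1 2]
    by (simp add: eval_nat_numeral algebra_simps)
next
  case (3 k)
  have "cheb (Suc (Suc k) + 2) (tr 1 q) - cheb (Suc (Suc k)) (tr 1 q)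
      = tr 1 q * tr (Suc k + 2) q - tr (k + 2) q"
    unfolding 3[symmetric] by (simp add: algebra_simps)
  then show ?case
    using tr_mult[OF assms, of 1 "Suc k + 2"] by simp
qed

lemma alpha_nonneg: "norm q = 1 \<Longrightarrow> 0 \<le> alpha q"
  using tr_le_2[of q 2] by (simp add: densities_tr)

lemma alpha_symmetric:
  "norm q = 1 \<Longrightarrow> alpha (- q) = alpha q" "norm q = 1 \<Longrightarrow> alpha (inverse q) = alpha q"
  by (simp_all add: densities_tr)

lemma sum_unif_alpha_cheb:
  assumes "n \<ge> 1"
  shows "(\<Sum>q\<in>roots_of_unity (2 * n). unif_weight n q * alpha q * cheb k (tr 1 q))
    = (if 2 * n dvd k then 1 else 0) - (if 2 * n dvd k + 2 then 1 else 0)"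
proof -
  have "(\<Sum>q\<in>roots_of_unity (2 * n). unif_weight n q * alpha q * cheb k (tr 1 q))
      = (\<Sum>q\<in>roots_of_unity (2 * n). unif_weight n q * tr k q / 2 - unif_weight n q * tr (k + 2) q / 2)"
    by (rule sum.cong) (use assms norm_root_of_unity in \<open>auto simp: mult.assoc alpha_cheb right_diff_distrib diff_divide_distrib simp del: One_nat_def\<close>)
  then show ?thesis
    using assms by (simp add: sum_subtractf sum_divide_distrib[symmetric] sum_unif_tr)
qed

lemma sum_odd_alpha_cheb:
  assumes "n \<ge> 1" "k + 2 < 4 * n"
  shows "(\<Sum>q\<in>roots_of_unity (4 * n). odd_weight n q * alpha q * cheb k (tr 1 q))
    = (if k = 0 then 1 else if k = 2 * n then - 1 else 0) + (if k + 2 = 2 * n then 1 else 0)"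
proof -
  have "(\<Sum>q\<in>roots_of_unity (4 * n). odd_weight n q * alpha q * cheb k (tr 1 q))
      = (\<Sum>q\<in>roots_of_unity (4 * n). odd_weight n q * tr k q / 2 - odd_weight n q * tr (k + 2) q / 2)"
    by (rule sum.cong) (use assms norm_root_of_unity[of _ "4 * n"] in \<open>auto simp: mult.assoc alpha_cheb right_diff_distrib diff_divide_distrib simp del: One_nat_def\<close>)
  also have "\<dots> = (\<Sum>q\<in>roots_of_unity (4 * n). odd_weight n q * tr k q) / 2
      - (\<Sum>q\<in>roots_of_unity (4 * n). odd_weight n q * tr (k + 2) q) / 2"
    by (simp add: sum_subtractf sum_divide_distrib)
  also have "\<dots> = (if k = 0 then 1 else if k = 2 * n then - 1 else 0) + (if k + 2 = 2 * n then 1 else 0)"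
  proof -
    have dvd: "2 * n dvd j \<longleftrightarrow> j = 0 \<or> j = 2 * n" "4 * n dvd j \<longleftrightarrow> j = 0" if "j < 4 * n" for j
    proof -
      have "m < 2" if "j = 2 * n * m" for m using that \<open>j < 4 * n\<close> assms(1) by (cases "m < 2") auto
      then show "2 * n dvd j \<longleftrightarrow> j = 0 \<or> j = 2 * n" by (auto simp: less_2_cases_iff elim!: dvdE)
      show "4 * n dvd j \<longleftrightarrow> j = 0" using \<open>j < 4 * n\<close> by (auto dest: dvd_imp_le)
    qed
    have "(\<Sum>q\<in>roots_of_unity (4 * n). odd_weight n q * tr j q)
        = (if 4 * n dvd j then 2 else if 2 * n dvd j then - 2 else 0)" for j
      by (rule sum_odd_tr) (use assms in auto)
    then show ?thesis
      using assms dvd[of k] dvd[of "k + 2"] by (simp only:) auto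
  qed
  finally show ?thesis .
qed

text \<open>
  The component at \<open>v\<close> is the Chebyshev polynomial of degree \<open>v - 1\<close>. The equation at the last vertex
  says that the polynomial of degree \<open>n - 1\<close> vanishes, which holds at all \<open>2n\<close>-th roots of unity
  except \<open>\<plusminus>1\<close>, where the density \<open>alpha\<close> vanishes.
\<close>

lemma circular_measure_A:
  assumes n: "n \<ge> 3"
  shows "circular_measure (A_graph (n - 1)) = with_density alpha (d_unif n)"
proof
  fix S
  let ?X = "A_graph (n - 1)"
  have "circular_measure ?X S
      = (\<Sum>q\<in>roots_of_unity (2 * n). (unif_weight n q * alpha q) * indicator S q)"
  proof (rule circular_measure_from_eigenfunctions[where f = "\<lambda>v q. cheb (v - 1) (tr 1 q)"])
    show "finite_rooted_bipartite ?X" using n by (intro bipartite_A) simp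
  next
    fix q :: complex and v assume q: "q ^ (2 * n) = 1" "norm q = 1" "unif_weight n q * alpha q \<noteq> 0"
      and "v \<in> verts ?X"
    then have v: "1 \<le> v" "v \<le> n - 1" by (auto simp: A_graph_def)
    have "tr (n - 1) q = 1 * tr (n + 1) q"
      by (rule tr_reflect) (use q n in \<open>auto simp flip: mult_2\<close>)
    then have "cheb (n - 1) (tr 1 q) = 0"
      using alpha_cheb[OF q(2), of "n - 1"] q(3) n by auto
    moreover have "nbr_sum (verts ?X) (edges ?X) (\<lambda>u. cheb (u - 1) (tr 1 q)) v
      = (if v < n - 1 then cheb v (tr 1 q) else 0) + (if 1 < v then cheb (v - 2) (tr 1 q) else 0)"
      using v by (simp add: A_graph_def nbr_sum_path numeral_2_eq_2)
    ultimately show "nbr_sum (verts ?X) (edges ?X) (\<lambda>u. cheb (u - 1) (tr 1 q)) v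
        = tr 1 q * cheb (v - 1) (tr 1 q)"
      using v n cheb_rec[of v "tr 1 q"] by (cases "v = n - 1") (auto simp: numeral_2_eq_2)
  next
    fix v assume "v \<in> verts ?X"
    then have v: "1 \<le> v" "v \<le> n - 1" by (auto simp: A_graph_def)
    then have "\<not> 2 * n dvd v - 1 + 2" "2 * n dvd v - 1 \<longleftrightarrow> v = 1" using n by (auto dest: dvd_imp_le)
    then show "(\<Sum>q\<in>roots_of_unity (2 * n). unif_weight n q * alpha q * cheb (v - 1) (tr 1 q))
        = (if v = root ?X then 1 else 0)"
      using n by (subst sum_unif_alpha_cheb) (simp_all add: A_graph_def)
  qed (use n in \<open>auto simp: A_graph_def unif_weight_nonneg alpha_nonneg alpha_symmetric\<close>)
  also have "\<dots> = with_density alpha (d_unif n) S"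
    using n by (subst with_density_unif[of n "2 * n"]) simp_all
  finally show "circular_measure ?X S = with_density alpha (d_unif n) S" .
qed

text \<open>
  By symmetry the two leaves get equal components, so the equation at the branching vertex makes
  each half of the next Chebyshev polynomial. The equations at the leaves become \<open>tr n q = 0\<close>, which
  characterises the odd \<open>4n\<close>-th roots of unity.
\<close>

lemma circular_measure_D:
  assumes n: "n \<ge> 2"
  shows "circular_measure (D_graph (n + 1)) = with_density alpha (d_odd n)"
proof
  fix S
  let ?X = "D_graph (n + 1)"
  define f where "f v q = (if v \<le> n - 1 then cheb (v - 1) (tr 1 q) else cheb (n - 1) (tr 1 q) / 2)" for v q
  have "circular_measure ?X S
      = (\<Sum>q\<in>roots_of_unity (4 * n). (odd_weight n q * alpha q) * indicator S q)"
  proof (rule circular_measure_from_eigenfunctions[where f = f])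
    show "finite_rooted_bipartite ?X" using n by (intro bipartite_D) simp
  next
    fix q :: complex and v assume q: "q ^ (4 * n) = 1" "norm q = 1" "odd_weight n q * alpha q \<noteq> 0"
      and "v \<in> verts ?X"
    then have v: "1 \<le> v" "v \<le> n + 1" by (auto simp: D_graph_def)
    have "q ^ (2 * n) = -1" using q(3) by (auto simp: odd_weight_def split: if_splits)
    then have "tr n q = -1 * tr n q"
      by (intro tr_reflect q(2)) (auto simp flip: mult_2)
    moreover have "n - 2 + 2 = n" using n by simp
    ultimately have leaf: "cheb n (tr 1 q) = cheb (n - 2) (tr 1 q)"
      using cheb_diff[OF q(2), of "n - 2"] by simp
    have nbr: "nbr_sum (verts ?X) (edges ?X) (\<lambda>u. f u q) v
      = (if v < n - 1 then f (Suc v) q else 0) + (if 1 < v \<and> v \<le> n - 1 then f (v - 1) q else 0)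
        + (if v = n - 1 then f n q + f (n + 1) q else 0)
        + (if v = n \<or> v = n + 1 then f (n - 1) q else 0)"
      using v n by (auto simp: D_graph_def nbr_sum_path nbr_sum_union nbr_sum_add_edge nbr_sum_empty)
    consider "v < n - 1" | "v = n - 1" | "v = n \<or> v = n + 1" using v by linarith
    then show "nbr_sum (verts ?X) (edges ?X) (\<lambda>u. f u q) v = tr 1 q * f v q"
    proof cases
      case 3
      then show ?thesis
        using n cheb_rec[of n "tr 1 q"] leaf unfolding nbr
        by (auto simp: f_def numeral_2_eq_2)
    qed (unfold nbr, use v n cheb_rec[of v "tr 1 q"] in \<open>auto simp: f_def numeral_2_eq_2\<close>, arith)
  next
    fix v assume "v \<in> verts ?X"
    then have v: "1 \<le> v" "v \<le> n + 1" by (auto simp: D_graph_def)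
    show "(\<Sum>q\<in>roots_of_unity (4 * n). odd_weight n q * alpha q * f v q)
        = (if v = root ?X then 1 else 0)"
    proof (cases "v \<le> n - 1")
      case True
      then show ?thesis using v n
        by (simp only: f_def if_True) (subst sum_odd_alpha_cheb, auto simp: D_graph_def)
    next
      case False
      then show ?thesis using v n
        by (simp only: f_def if_False times_divide_eq_right sum_divide_distrib[symmetric])
           (subst sum_odd_alpha_cheb, auto simp: D_graph_def)
    qed
  qed (use n in \<open>auto simp: f_def D_graph_def odd_weight_nonneg alpha_nonneg alpha_symmetric\<close>)
  also have "\<dots> = with_density alpha (d_odd n) S"
    using n by (subst with_density_odd[of n "4 * n"]) simp_all
  finally show "circular_measure ?X S = with_density alpha (d_odd n) S" .
qed

text \<open>
  The components are the symmetric combinations of the two characters \<open>v \<mapsto> q\<^sup>v\<close> and \<open>v \<mapsto> q\<^sup>-\<^sup>v\<close> of the cyclic group.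
\<close>

lemma circular_measure_A_tilde:
  assumes n: "n \<ge> 1"
  shows "circular_measure (A_tilde_graph (2 * n)) = (\<lambda>S. measure (d_unif n) S)"
proof
  fix S
  let ?X = "A_tilde_graph (2 * n)"
  have "circular_measure ?X S = (\<Sum>q\<in>roots_of_unity (2 * n). unif_weight n q * indicator S q)"
  proof (rule circular_measure_from_eigenfunctions[where f = "\<lambda>v q. tr v q / 2"])
    show "finite_rooted_bipartite ?X" using n by (intro bipartite_A_tilde) simp
  next
    fix q :: complex and v assume q: "q ^ (2 * n) = 1" "norm q = 1" and "v \<in> verts ?X"
    then have v: "v < 2 * n" by (auto simp: A_tilde_graph_def)
    have neq: "i \<noteq> Suc i mod (2 * n)" if "i < 2 * n" for i
      using that by (cases "Suc i = 2 * n") (auto, presburger)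
    have "nbr_sum (verts ?X) (edges ?X) (\<lambda>u. tr u q / 2) v
      = (\<Sum>i<2*n. if v = i then tr (Suc i mod (2 * n)) q / 2 else 0)
      + (\<Sum>i<2*n. if v = Suc i mod (2 * n) then tr i q / 2 else 0)"
      unfolding A_tilde_graph_def rooted_graph.simps
      by (rule nbr_sum_edge_family) (use n neq in auto)
    also have "(\<Sum>i<2*n. if v = Suc i mod (2 * n) then tr i q / 2 else 0)
      = (\<Sum>i<2*n. if i = (if v = 0 then 2 * n - 1 else v - 1) then tr (if v = 0 then 2 * n - 1 else v - 1) q / 2 else 0)"
    proof (rule sum.cong)
      fix i assume "i \<in> {..<2 * n}"
      then have "v = Suc i mod (2 * n) \<longleftrightarrow> i = (if v = 0 then 2 * n - 1 else v - 1)"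
        using v by (cases "Suc i = 2 * n") auto
      then show "(if v = Suc i mod (2 * n) then tr i q / 2 else 0)
        = (if i = (if v = 0 then 2 * n - 1 else v - 1) then tr (if v = 0 then 2 * n - 1 else v - 1) q / 2 else 0)"
        by simp
    qed simp
    finally have nbr: "nbr_sum (verts ?X) (edges ?X) (\<lambda>u. tr u q / 2) v
      = tr (Suc v mod (2 * n)) q / 2 + tr (if v = 0 then 2 * n - 1 else v - 1) q / 2"
      using v by auto
    have "tr (Suc v mod (2 * n)) q = tr (Suc v) q"
    proof (cases "Suc v = 2 * n")
      case True
      then show ?thesis using q by (simp add: tr_def)
    qed (use v in simp)
    moreover have "tr (2 * n - 1) q = 1 * tr 1 q"
      by (rule tr_reflect) (use q n in auto)
    ultimately show "nbr_sum (verts ?X) (edges ?X) (\<lambda>u. tr u q / 2) v = tr 1 q * (tr v q / 2)"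
      unfolding nbr using tr_mult[OF q(2), of 1 v] by (cases "v = 0") auto
  next
    fix v assume "v \<in> verts ?X"
    then have "2 * n dvd v \<longleftrightarrow> v = 0" by (auto simp: A_tilde_graph_def dest: dvd_imp_le)
    then show "(\<Sum>q\<in>roots_of_unity (2 * n). unif_weight n q * (tr v q / 2)) = (if v = root ?X then 1 else 0)"
      using n by (simp add: sum_divide_distrib[symmetric] sum_unif_tr A_tilde_graph_def)
  qed (use n in \<open>auto simp: A_tilde_graph_def unif_weight_nonneg\<close>)
  also have "\<dots> = measure (d_unif n) S"
  proof -
    have u: "with_density (\<lambda>_. 1) (d_unif n) S
        = (\<Sum>q\<in>roots_of_unity (2 * n). unif_weight n q * 1 * indicator S q)"
      using n by (intro with_density_unif) auto
    show ?thesis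
    by (simp only: measure_eq_with_density u mult_1_right)
  qed
  finally show "circular_measure ?X S = measure (d_unif n) S" .
qed

text \<open>
  The two leaves at the root's end split the basis vector of the root into halves that are symmetric and
  antisymmetric under exchange of these leaves. The antisymmetric half is an eigenvector for the
  eigenvalue \<open>0\<close> and contributes \<open>d\<^sub>1'\<close>; the symmetric half unfolds to \<open>d\<^sub>n\<close>. For even \<open>n\<close> both halves
  are present at \<open>q = \<plusminus>\<i>\<close>, so that the general form of the eigenvector criterion is needed.
\<close>

lemma circular_measure_D_tilde:
  assumes n: "n \<ge> 2"
  shows "circular_measure (D_tilde_graph (n + 2))
    = (\<lambda>S. (measure (d_unif n) S + measure (d_odd 1) S) / 2)"
proof
  fix S
  define X where "X = D_tilde_graph (n + 2)"
  let ?R = "roots_of_unity (4 * n)"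
  \<comment> \<open>\<open>f\<close> is the symmetric and \<open>g\<close> the antisymmetric part.\<close>
  define f where "f v q = (if v \<le> n - 1 then tr v q else if v \<le> n + 1 then 1 else tr n q / 2)" for v q
  have f_simps: "v \<le> n - 1 \<Longrightarrow> f v = tr v" "v = n \<or> v = n + 1 \<Longrightarrow> f v = (\<lambda>q. 1)"
    "n + 1 < v \<Longrightarrow> f v = (\<lambda>q. tr n q / 2)" for v
    using n by (auto simp: f_def fun_eq_iff)
  define g where "g v = (if v = n then 1 else if v = n + 1 then - 1 else 0 :: real)" for v
  have X: "X = \<lparr>verts = {1..n + 3}, edges = path_edges 1 (n - 1) +
       {# {1, n}, {1, n + 1}, {n - 1, n + 2}, {n - 1, n + 3} #}, root = n\<rparr>"
  proof -
    have "n + 2 - 3 = n - 1" "n + 2 - 2 = n" "n + 2 - 1 = n + 1" "n + 2 + 1 = n + 3" using n by auto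
    then show ?thesis by (simp only: X_def D_tilde_graph_def)
  qed
  have nbr: "nbr_sum (verts X) (edges X) k v
      = (if v < n - 1 then k (Suc v) else 0) + (if 1 < v \<and> v \<le> n - 1 then k (v - 1) else 0)
        + (if v = 1 then k n + k (n + 1) else 0) + (if v = n - 1 then k (n + 2) + k (n + 3) else 0)
        + (if v = n \<or> v = n + 1 then k 1 else 0) + (if n + 2 \<le> v then k (n - 1) else 0)"
    if "v \<in> verts X" for v k
  proof -
    have "1 \<le> v" "v \<le> n + 3" using that by (auto simp: X)
    have p: "nbr_sum {1..n + 3} (path_edges 1 (n - 1)) k v
      = (if 1 \<le> v \<and> v < n - 1 then k (Suc v) else 0) + (if 1 < v \<and> v \<le> n - 1 then k (v - 1) else 0)"
      by (rule nbr_sum_path) auto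
    have e: "nbr_sum {1..n + 3} {# {1, n}, {1, n + 1}, {n - 1, n + 2}, {n - 1, n + 3} #} k v
      = (if v = 1 then k n else 0) + (if v = n then k 1 else 0)
      + ((if v = 1 then k (n + 1) else 0) + (if v = n + 1 then k 1 else 0)
      + ((if v = n - 1 then k (n + 2) else 0) + (if v = n + 2 then k (n - 1) else 0)
      + ((if v = n - 1 then k (n + 3) else 0) + (if v = n + 3 then k (n - 1) else 0) + 0)))"
    proof -
      have "{1, n - 1, n, n + 1, n + 2, n + 3} \<subseteq> {1..n + 3}"
        "1 \<noteq> n" "1 \<noteq> n + 1" "n - 1 \<noteq> n + 2" "n - 1 \<noteq> n + 3" using n by auto
      then show ?thesis
        by (simp only: nbr_sum_add_edge finite_atLeastAtMost insert_subset nbr_sum_empty simp_thms)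
    qed
    show ?thesis
    proof (cases "v < n")
      case True
      then have "v \<noteq> n" "v \<noteq> n + 1" "v \<noteq> n + 2" "v \<noteq> n + 3" "\<not> n + 2 \<le> v" "v \<le> n - 1" by auto
      then show ?thesis
        unfolding X rooted_graph.simps nbr_sum_union p e using \<open>1 \<le> v\<close> by simp
    next
      case False
      then have "v = n \<or> v = n + 1 \<or> v = n + 2 \<or> v = n + 3" using \<open>v \<le> n + 3\<close> by linarith
      then show ?thesis
        unfolding X rooted_graph.simps nbr_sum_union p e using n by (elim disjE) simp_all
    qed
  qed
  have f: "nbr_sum (verts X) (edges X) (\<lambda>u. f u q) v = tr 1 q * f v q"
    if q: "norm q = 1" "q ^ (2 * n) = 1" and v: "v \<in> verts X" for q v
  proof -
    have "tr (n - 1) q = 1 * tr (n + 1) q"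
      by (rule tr_reflect) (use q n in \<open>auto simp flip: mult_2\<close>)
    then have reflect: "tr (n - 1) q = tr (n + 1) q" by simp
    have "1 \<le> v" "v \<le> n + 3" using v by (auto simp: X)
    then consider "v = 1" | "1 < v" "v < n - 1" | "1 < v" "v = n - 1" | "v = n \<or> v = n + 1" "1 < v" | "n + 2 \<le> v"
      using n by linarith
    then show ?thesis
    proof cases
      case 2
      then show ?thesis using tr_mult[OF q(1), of 1 v] unfolding nbr[OF v] by (auto simp: f_def)
    next
      case 3
      then have "Suc v = n" using n by simp
      then show ?thesis using 3 tr_mult[OF q(1), of 1 v] unfolding nbr[OF v] by (auto simp: f_def)
    next
      case 1
      consider "n = 2" | "1 < n - 1" "n - 1 < n" using n by linarith
      then show ?thesis
        using tr_mult[OF q(1), of 1 1] 1 unfolding nbr[OF v] by cases (auto simp: f_def numeral_2_eq_2)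
    next
      case 4
      then show ?thesis using n unfolding nbr[OF v] by (auto simp: f_def)
    next
      case 5
      then show ?thesis using n reflect tr_mult[OF q(1), of 1 n] unfolding nbr[OF v] by (auto simp: f_def)
    qed
  qed
  have g: "nbr_sum (verts X) (edges X) g v = 0" if v: "v \<in> verts X" for v
  proof -
    have "(if v < n - 1 then g (Suc v) else 0) = 0" "(if 1 < v \<and> v \<le> n - 1 then g (v - 1) else 0) = 0"
      "(if v = 1 then g n + g (n + 1) else 0) = 0" "(if v = n - 1 then g (n + 2) + g (n + 3) else 0) = 0"
      "(if v = n \<or> v = n + 1 then g 1 else 0) = 0" "(if n + 2 \<le> v then g (n - 1) else 0) = 0"
      using n by (auto simp: g_def)
    then show ?thesis unfolding nbr[OF v] by (simp only: add_0_left)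
  qed
  have unif: "with_density (\<lambda>_. 1) (d_unif n) S = (\<Sum>q\<in>?R. unif_weight n q * 1 * indicator S q)"
    using n by (intro with_density_unif) auto
  have odd: "with_density (\<lambda>_. 1) (d_odd 1) S = (\<Sum>q\<in>?R. odd_weight 1 q * 1 * indicator S q)"
    using n by (intro with_density_odd) auto
  have "circular_measure X S = (\<Sum>q\<in>?R. (unif_weight n q + odd_weight 1 q) / 2 * indicator S q)"
  proof (rule circular_measure_from_eigenvectors[where
        h = "\<lambda>v q. unif_weight n q / 2 * f v q + odd_weight 1 q / 2 * g v"])
    show "finite_rooted_bipartite X" unfolding X_def using n by (intro bipartite_D_tilde) simp
  next
    fix q :: complex and v assume q: "q ^ (4 * n) = 1" and v: "v \<in> verts X"
    have unit: "norm q = 1" using norm_root_of_unity[OF q] n by simp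
    have "nbr_sum (verts X) (edges X) (\<lambda>u. unif_weight n q / 2 * f u q + odd_weight 1 q / 2 * g u) v
      = (unif_weight n q * nbr_sum (verts X) (edges X) (\<lambda>u. f u q) v
        + odd_weight 1 q * nbr_sum (verts X) (edges X) g v) / 2"
      by (simp only: nbr_sum_add nbr_sum_scale) simp
    also have "unif_weight n q * nbr_sum (verts X) (edges X) (\<lambda>u. f u q) v
        = unif_weight n q * (tr 1 q * f v q)"
      using f[OF unit _ v] by (simp add: unif_weight_def)
    also have "odd_weight 1 q * nbr_sum (verts X) (edges X) g v = odd_weight 1 q * (tr 1 q * g v)"
    proof (cases "q ^ 2 = -1")
      case True
      then have "tr 1 q = -1 * tr 1 q" by (intro tr_reflect unit) (simp_all add: numeral_2_eq_2)
      then show ?thesis using g[OF v] by simp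
    qed (simp add: odd_weight_def)
    finally show "nbr_sum (verts X) (edges X) (\<lambda>u. unif_weight n q / 2 * f u q + odd_weight 1 q / 2 * g u) v
        = 2 * Re q * (unif_weight n q / 2 * f v q + odd_weight 1 q / 2 * g v)"
      by (simp add: tr_def algebra_simps)
  next
    fix v assume "v \<in> verts X"
    then have v: "1 \<le> v" "v \<le> n + 3" by (auto simp: X)
    have u: "(\<Sum>q\<in>?R. unif_weight n q * tr j q) = (if 2 * n dvd j then 2 else 0)" for j
      using n by (intro sum_unif_tr) auto
    have o: "(\<Sum>q\<in>?R. odd_weight 1 q) = 1"
      using sum_odd_tr[of 1 "4 * n" 0] n by (simp flip: sum_distrib_right)
    have "(\<Sum>q\<in>?R. unif_weight n q) = 1"
      using u[of 0] by (simp flip: sum_distrib_right)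
    moreover have "\<not> 2 * n dvd v" if "v \<le> n" using that v n by (auto dest: dvd_imp_le)
    moreover have "\<not> 2 * n dvd n" using n by (auto dest: dvd_imp_le)
    ultimately have "(\<Sum>q\<in>?R. unif_weight n q * f v q) = (if v = n \<or> v = n + 1 then 1 else 0)"
    proof -
      consider "v \<le> n - 1" | "v = n \<or> v = n + 1" | "n + 1 < v" by linarith
      then show ?thesis
      proof cases
        case 1
        then show ?thesis using u[of v] \<open>v \<le> n \<Longrightarrow> \<not> 2 * n dvd v\<close> n by (auto simp: f_simps(1))
      next
        case 2
        then show ?thesis using \<open>(\<Sum>q\<in>?R. unif_weight n q) = 1\<close> by (simp add: f_simps(2))
      next
        case 3
        then show ?thesis using u[of n] \<open>\<not> 2 * n dvd n\<close>
          by (simp add: f_simps(3) flip: sum_divide_distrib)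
      qed
    qed
    moreover have "(\<Sum>q\<in>?R. odd_weight 1 q * g v) = g v"
      using o by (simp flip: sum_distrib_right)
    ultimately show "(\<Sum>q\<in>?R. unif_weight n q / 2 * f v q + odd_weight 1 q / 2 * g v)
        = (if v = root X then 1 else 0)"
      by (simp only: sum.distrib times_divide_eq_left sum_divide_distrib[symmetric]) (simp add: X g_def)
  qed (use n in \<open>auto simp: X f_def g_def unif_weight_nonneg odd_weight_nonneg\<close>)
  also have "\<dots> = (measure (d_unif n) S + measure (d_odd 1) S) / 2"
    unfolding measure_eq_with_density unif odd
    by (simp only: add_divide_distrib distrib_right sum.distrib sum_divide_distrib times_divide_eq_left mult_1_right)
  finally show "circular_measure (D_tilde_graph (n + 2)) S = (measure (d_unif n) S + measure (d_odd 1) S) / 2"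
    unfolding X_def .
qed

section \<open>Trees with three legs\<close>

lemma nbr_sum_three_legs:
  assumes "a \<ge> 1" "b \<ge> 1" "c \<ge> 1" "v \<le> a + b + c"
  shows "nbr_sum (verts (three_legs a b c)) (edges (three_legs a b c)) g v =
    (if v = 0 then g 1 + g (a + 1) + g (a + b + 1)
     else g (if v = a + 1 \<or> v = a + b + 1 then 0 else v - 1)
       + (if v = a \<or> v = a + b \<or> v = a + b + c then 0 else g (Suc v)))"
proof -
  let ?V = "{0..a + b + c}"
  have centre: "nbr_sum ?V {# {0, 1}, {0, a + 1}, {0, a + b + 1} #} g v
    = (if v = 0 then g 1 + g (a + 1) + g (a + b + 1) else 0)
      + (if v = 1 \<or> v = a + 1 \<or> v = a + b + 1 then g 0 else 0)"
    using assms by (simp add: nbr_sum_add_edge nbr_sum_empty)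
  have "nbr_sum ?V (path_edges 1 a) g v
      = (if 1 \<le> v \<and> v < a then g (Suc v) else 0) + (if 1 < v \<and> v \<le> a then g (v - 1) else 0)"
    "nbr_sum ?V (path_edges (a + 1) (a + b)) g v
      = (if a + 1 \<le> v \<and> v < a + b then g (Suc v) else 0) + (if a + 1 < v \<and> v \<le> a + b then g (v - 1) else 0)"
    "nbr_sum ?V (path_edges (a + b + 1) (a + b + c)) g v
      = (if a + b + 1 \<le> v \<and> v < a + b + c then g (Suc v) else 0)
        + (if a + b + 1 < v \<and> v \<le> a + b + c then g (v - 1) else 0)"
    by (rule nbr_sum_path; simp)+
  note paths = this
  consider "v = 0" | "1 \<le> v" "v \<le> a" | "a + 1 \<le> v" "v \<le> a + b" | "a + b + 1 \<le> v" "v \<le> a + b + c"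
    using assms(4) by linarith
  then show ?thesis
    unfolding three_legs_def rooted_graph.simps nbr_sum_union centre paths
    by cases (use assms in auto)
qed

text \<open>
  The eigenvector equations at the centre, inside the legs and at their ends, for the numbering of
  vertices used by \<open>three_legs\<close>.
\<close>

lemma circular_measure_three_legs:
  fixes f :: "nat \<Rightarrow> complex \<Rightarrow> real"
  assumes legs: "a \<ge> 1" "b \<ge> 1" "c \<ge> 1" and m: "0 < m" "even m"
    and eig: "\<And>q v. q ^ m = 1 \<Longrightarrow> norm q = 1 \<Longrightarrow> w q \<noteq> 0 \<Longrightarrow> v \<le> a + b + c \<Longrightarrow>
      (if v = 0 then f 1 q + f (a + 1) q + f (a + b + 1) q
       else f (if v = a + 1 \<or> v = a + b + 1 then 0 else v - 1) q
         + (if v = a \<or> v = a + b \<or> v = a + b + c then 0 else f (Suc v) q)) = tr 1 q * f v q"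
    and unit: "\<And>v. v \<le> a + b + c \<Longrightarrow>
      (\<Sum>q\<in>roots_of_unity m. w q * f v q) = (if v = a then 1 else 0)"
    and root: "\<And>q. f a q = 1"
    and nonneg: "\<And>q. q ^ m = 1 \<Longrightarrow> norm q = 1 \<Longrightarrow> 0 \<le> w q"
    and sym: "\<And>q. norm q = 1 \<Longrightarrow> w (- q) = w q" "\<And>q. norm q = 1 \<Longrightarrow> w (inverse q) = w q"
  shows "circular_measure (three_legs a b c) S = (\<Sum>q\<in>roots_of_unity m. w q * indicator S q)"
proof (rule circular_measure_from_eigenfunctions[OF bipartite_three_legs[OF legs] m, where f = f])
  have verts: "v \<le> a + b + c" if "v \<in> verts (three_legs a b c)" for v
    using that by (simp add: three_legs_def)
  have rt: "root (three_legs a b c) = a" by (simp add: three_legs_def)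
  show "nbr_sum (verts (three_legs a b c)) (edges (three_legs a b c)) (\<lambda>u. f u q) v = tr 1 q * f v q"
    if "q ^ m = 1" "norm q = 1" "w q \<noteq> 0" "v \<in> verts (three_legs a b c)" for q v
    unfolding nbr_sum_three_legs[OF legs verts[OF that(4)]] by (rule eig[OF that(1-3) verts[OF that(4)]])
  show "(\<Sum>q\<in>roots_of_unity m. w q * f v q) = (if v = root (three_legs a b c) then 1 else 0)"
    if "v \<in> verts (three_legs a b c)" for v
    unfolding rt by (rule unit[OF verts[OF that]])
  show "f (root (three_legs a b c)) q = 1" for q unfolding rt by (rule root)
qed (fact nonneg sym)+

text \<open>
  Division of the quadratic equation by \<open>z\<close> turns its left side into \<open>z + cnj z\<close>.
\<close>

lemma Re_eq_if_palindromic: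
  assumes "norm z = 1" "z\<^sup>2 + 1 = of_real a * z"
  shows "2 * Re z = a"
proof -
  have zc: "z * cnj z = 1" using assms(1) by (simp add: complex_mult_cnj flip: cmod_power2)
  have "(z\<^sup>2 + 1) * cnj z = of_real a * (z * cnj z)" using assms(2) by simp
  moreover have "(z\<^sup>2 + 1) * cnj z = z * (z * cnj z) + cnj z" by (simp add: power2_eq_square algebra_simps)
  ultimately have "z + cnj z = of_real a" using zc by simp
  then show ?thesis by (simp add: complex_add_cnj complex_eq_iff)
qed

lemma Re_primitive_6th_root:
  assumes "norm z = 1" "z ^ 3 = -1" "z \<noteq> -1"
  shows "2 * Re z = 1"
proof -
  have "(z + 1) * (z\<^sup>2 + 1 - z) = z ^ 3 + 1" by (simp add: algebra_simps eval_nat_numeral)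
  then have "(z + 1) * (z\<^sup>2 + 1 - z) = 0" using assms(2) by simp
  moreover have "z + 1 \<noteq> 0" using assms(3) by (simp add: add_eq_0_iff2)
  ultimately have "z\<^sup>2 + 1 - z = 0" using mult_eq_0_iff by blast
  then have "z\<^sup>2 + 1 = of_real 1 * z" by simp
  then show ?thesis by (rule Re_eq_if_palindromic[OF assms(1)])
qed

lemma Re_primitive_3rd_root:
  assumes "norm z = 1" "z ^ 3 = 1" "z \<noteq> 1"
  shows "2 * Re z = -1"
  using Re_primitive_6th_root[of "- z"] assms by (simp add: minus_equation_iff[of z])

text \<open>
  The weight depends only on \<open>z = q\<^sup>2\<close>, a twelfth root of unity. It vanishes if \<open>z\<close> has order
  \<open>1\<close>, \<open>2\<close>, \<open>4\<close> or \<open>6\<close>. The remaining orders \<open>3\<close> and \<open>12\<close> yield the six eigenvalues, which are the roots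
  of the characteristic polynomial \<open>tr 6 q + tr 4 q - 1\<close>.
\<close>

lemma E6_weight_support:
  assumes q: "q ^ 24 = 1" "norm q = 1"
  defines "w \<equiv> unif_weight 12 q * alpha q
    + (unif_weight 12 q - unif_weight 6 q - unif_weight 4 q + unif_weight 3 q) / 2"
  shows "0 \<le> w \<and> (w = 0 \<or> tr 6 q = 1 - tr 4 q)"
proof -
  define z where "z = q\<^sup>2"
  have norm: "norm z = 1" "norm (z\<^sup>2) = 1" using q(2) by (auto simp: z_def norm_power)
  have u: "unif_weight n q = (if z ^ n = 1 then 1 / (2 * n) else 0)" for n
    by (simp add: unif_weight_def z_def power_mult)
  have t: "tr 2 q = 2 * Re z" "tr 4 q = 2 * Re (z\<^sup>2)"
    by (simp_all add: tr_def z_def flip: power_mult)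
  have t4: "tr 4 q = tr 2 q * tr 2 q - 2" and t6: "tr 6 q = tr 2 q * (tr 4 q - 1)"
    using tr_mult[OF q(2), of 2 2] tr_mult[OF q(2), of 2 4] by (simp_all add: algebra_simps)
  have z12: "z ^ 12 = 1" using q(1) by (simp add: z_def power_mult[symmetric])
  have p: "z ^ 4 = z ^ 3 * z" "z ^ 6 = (z ^ 3)\<^sup>2" "z ^ 12 = (z ^ 6)\<^sup>2" "z ^ 6 = (z\<^sup>2) ^ 3" "z ^ 4 = (z\<^sup>2)\<^sup>2"
    by (simp_all add: power_mult[symmetric] flip: power_Suc2)
  have "z ^ 6 = -1 \<or> z ^ 3 = -1 \<or> z ^ 3 = 1"
    using z12 unfolding p(3) power2_eq_1_iff unfolding p(2) power2_eq_1_iff by blast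
  then consider "z\<^sup>2 = -1" | "z ^ 6 = -1" "z\<^sup>2 \<noteq> -1" | "z = -1" | "z ^ 3 = -1" "z \<noteq> -1"
    | "z = 1" | "z ^ 3 = 1" "z \<noteq> 1" by blast
  then show ?thesis
  proof cases
    case 1
    have "z ^ 6 = -1" unfolding p(4) 1 by simp
    moreover from this have "z ^ 3 \<noteq> 1" unfolding p(2) by (metis one_neq_neg_one power_one)
    moreover have "z ^ 4 = 1" unfolding p(5) 1 by simp
    moreover have "tr 2 q = 0" using t4 unfolding t(2) 1 by simp
    ultimately have "w = 0" unfolding w_def u densities_tr z12 by simp
    then show ?thesis by simp
  next
    case 2
    have "tr 4 q = 1" unfolding t(2)
      by (rule Re_primitive_6th_root[OF norm(2) _ 2(2)]) (simp only: p(4)[symmetric] 2(1))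
    moreover have "z\<^sup>2 \<noteq> 1" using 2(1) unfolding p(4) by (metis one_neq_neg_one power_one)
    then have "z ^ 4 \<noteq> 1" using 2(2) unfolding p(5) power2_eq_1_iff by blast
    moreover have "z ^ 3 \<noteq> 1" using 2(1) unfolding p(2) by (metis one_neq_neg_one power_one)
    ultimately show ?thesis
      using alpha_nonneg[OF q(2)] unfolding w_def u z12 2(1) t6 by simp
  next
    case 3
    have "w = 0" unfolding w_def u densities_tr t 3 by simp
    then show ?thesis by simp
  next
    case 4
    have "tr 2 q = 1" unfolding t(1) by (rule Re_primitive_6th_root[OF norm(1) 4])
    moreover have "z ^ 4 \<noteq> 1" unfolding p(1) 4(1) using 4(2) by (simp add: minus_equation_iff[of z])
    moreover have "z ^ 6 = 1" unfolding p(2) 4(1) by simp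
    ultimately have "w = 0" unfolding w_def u densities_tr z12 4(1) by simp
    then show ?thesis by simp
  next
    case 5
    have "w = 0" unfolding w_def u densities_tr t 5 by simp
    then show ?thesis by simp
  next
    case 6
    have t2: "tr 2 q = -1" unfolding t(1) by (rule Re_primitive_3rd_root[OF norm(1) 6])
    moreover have "z ^ 4 \<noteq> 1" unfolding p(1) 6(1) using 6(2) by simp
    moreover have "z ^ 6 = 1" unfolding p(2) 6(1) by simp
    ultimately have "w = 1 / 8" unfolding w_def u densities_tr z12 6(1) by simp
    then show ?thesis unfolding t6 t4 t2 by simp
  qed
qed

text \<open>
  The list gives the components at the vertices \<open>0, \<dots>, 5\<close>. Only the equations at \<open>3\<close> and \<open>4\<close>, the
  neighbours of the centre on the legs without the root, use the relation that holds on the support.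
\<close>

lemma circular_measure_E6:
  "circular_measure E6_graph = (\<lambda>S. with_density alpha (d_unif 12) S
    + (measure (d_unif 12) S - measure (d_unif 6) S - measure (d_unif 4) S + measure (d_unif 3) S) / 2)"
proof
  fix S
  let ?X = "E6_graph" and ?R = "roots_of_unity 24"
  define w where "w q = unif_weight 12 q * alpha q
    + (unif_weight 12 q - unif_weight 6 q - unif_weight 4 q + unif_weight 3 q) / 2" for q
  define f where "f v q = [1 + tr 2 q, tr 1 q, 1, tr 1 q - tr 5 q, tr 3 q + tr 5 q, tr 4 q] ! v" for v q
  have vs: "v = 0 \<or> v = 1 \<or> v = 2 \<or> v = 3 \<or> v = 4 \<or> v = 5" if "v \<le> 2 + 1 + 2" for v :: nat
    using that by auto
  have mom: "(\<Sum>q\<in>?R. w q * tr j q) = (\<Sum>q\<in>?R. unif_weight 12 q * tr j q)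
    - (\<Sum>q\<in>?R. unif_weight 12 q * (tr 2 q * tr j q)) / 2
    + ((\<Sum>q\<in>?R. unif_weight 12 q * tr j q) - (\<Sum>q\<in>?R. unif_weight 6 q * tr j q)
      - (\<Sum>q\<in>?R. unif_weight 4 q * tr j q) + (\<Sum>q\<in>?R. unif_weight 3 q * tr j q)) / 2" for j
    unfolding sum_divide_distrib sum.distrib[symmetric] sum_subtractf[symmetric]
    by (rule sum.cong) (simp_all add: w_def densities_tr field_simps)
  have "(\<Sum>q\<in>?R. w q * tr 0 q) = 2"
    unfolding mom by (simp add: sum_unif_tr sum_unif_tr_tr del: tr_0)
  then have one: "(\<Sum>q\<in>?R. w q) = 1"
    by (simp flip: sum_distrib_right)
  have "circular_measure ?X S = (\<Sum>q\<in>?R. w q * indicator S q)"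
    unfolding E6_graph_def
  proof (rule circular_measure_three_legs[where f = f])
    fix q :: complex and v :: nat
    assume q: "q ^ 24 = 1" "norm q = 1" "w q \<noteq> 0" and v: "v \<le> 2 + 1 + 2"
    have rel: "tr 6 q = 1 - tr 4 q" using E6_weight_support[OF q(1,2)] q(3) by (auto simp: w_def)
    show "(if v = 0 then f 1 q + f (2 + 1) q + f (2 + 1 + 1) q
       else f (if v = 2 + 1 \<or> v = 2 + 1 + 1 then 0 else v - 1) q
        + (if v = 2 \<or> v = 2 + 1 \<or> v = 2 + 1 + 2 then 0 else f (Suc v) q)) = tr 1 q * f v q"
      using vs[OF v] by (elim disjE) (simp_all add: f_def distrib_left right_diff_distrib rel
        tr_1_mult[OF q(2), unfolded One_nat_def])
  next
    fix v :: nat assume v: "v \<le> 2 + 1 + 2"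
    show "(\<Sum>q\<in>?R. w q * f v q) = (if v = 2 then 1 else 0)"
      using vs[OF v] one by (elim disjE)
        (simp_all add: f_def distrib_left right_diff_distrib sum.distrib sum_subtractf mom
          sum_unif_tr sum_unif_tr_tr)
  qed (use E6_weight_support in \<open>auto simp: w_def f_def alpha_symmetric\<close>)
  also have "\<dots> = with_density alpha (d_unif 12) S
    + (measure (d_unif 12) S - measure (d_unif 6) S - measure (d_unif 4) S + measure (d_unif 3) S) / 2"
  proof -
    have "\<And>l. with_density l (d_unif 12) S = (\<Sum>q\<in>?R. unif_weight 12 q * l q * indicator S q)"
      "\<And>l. with_density l (d_unif 6) S = (\<Sum>q\<in>?R. unif_weight 6 q * l q * indicator S q)"
      "\<And>l. with_density l (d_unif 4) S = (\<Sum>q\<in>?R. unif_weight 4 q * l q * indicator S q)"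
      "\<And>l. with_density l (d_unif 3) S = (\<Sum>q\<in>?R. unif_weight 3 q * l q * indicator S q)"
      by (rule with_density_unif; simp)+
    then show ?thesis
      unfolding measure_eq_with_density
      by (simp only: sum.distrib[symmetric] sum_subtractf[symmetric] sum_divide_distrib)
         (rule sum.cong, simp_all add: w_def field_simps)
  qed
  finally show "circular_measure ?X S = with_density alpha (d_unif 12) S
    + (measure (d_unif 12) S - measure (d_unif 6) S - measure (d_unif 4) S + measure (d_unif 3) S) / 2" .
qed

text \<open>
  With \<open>z = q\<^sup>2\<close>, an eighteenth root of unity, the weight is supported where \<open>z\<close> has order \<open>2\<close> or
  \<open>18\<close>. These are the zeros of \<open>tr 1 q * (tr 6 q - 1)\<close>; for order \<open>6\<close> the summands cancel.
\<close>

lemma E7_weight_support: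
  assumes q: "q ^ 36 = 1" "norm q = 1"
  defines "w \<equiv> odd_weight 9 q * beta q + (odd_weight 1 q - odd_weight 3 q) / 2"
  shows "0 \<le> w \<and> (w = 0 \<or> tr 7 q = tr 1 q - tr 5 q)"
proof -
  define z where "z = q\<^sup>2"
  have norm: "norm (z\<^sup>2) = 1" "norm (z ^ 3) = 1" using q(2) by (auto simp: z_def norm_power)
  have u: "odd_weight n q = (if z ^ n = -1 then 1 / (2 * n) else 0)" for n
    by (simp add: odd_weight_def z_def power_mult)
  have t: "tr 4 q = 2 * Re (z\<^sup>2)" "tr 6 q = 2 * Re (z ^ 3)"
    by (simp_all add: tr_def z_def flip: power_mult)
  have t7: "tr 7 q = tr 1 q * tr 6 q - tr 5 q" using tr_1_mult(6)[OF q(2)] by simp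
  have p: "z ^ 9 = (z ^ 3) ^ 3" "z ^ 1 = z" by (simp_all flip: power_mult)
  consider "z = -1" | "z ^ 3 = -1" "z \<noteq> -1" | "z ^ 9 = -1" "z ^ 3 \<noteq> -1" | "z ^ 9 \<noteq> -1" by blast
  then show ?thesis
  proof cases
    case 1
    have "q ^ (1 + 1) = of_real (-1)" using 1 by (simp add: z_def numeral_2_eq_2)
    then have "tr 1 q = -1 * tr 1 q" by (intro tr_reflect q(2)) simp_all
    then have "tr 7 q = tr 1 q - tr 5 q" unfolding t7 by simp
    moreover have "w = 1 / 6" unfolding w_def u densities_tr t 1 by simp
    ultimately show ?thesis by simp
  next
    case 2
    \<comment> \<open>Here \<open>z\<close> has order \<open>6\<close>, so \<open>z\<^sup>2\<close> has order \<open>3\<close>.\<close>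
    have "(z\<^sup>2) ^ 3 = (z ^ 3)\<^sup>2" by (simp flip: power_mult)
    then have "(z\<^sup>2) ^ 3 = 1" unfolding 2(1) by simp
    moreover have "z\<^sup>2 \<noteq> 1" unfolding power2_eq_1_iff using 2 by auto
    ultimately have "tr 4 q = -1" unfolding t(1) by (rule Re_primitive_3rd_root[OF norm(1)])
    moreover have "z ^ 9 = -1" unfolding p 2(1) by simp
    ultimately have "w = 0" using 2(2) unfolding w_def u densities_tr 2(1) p(2) by simp
    then show ?thesis by simp
  next
    case 3
    have "tr 6 q = 1" unfolding t(2)
      by (rule Re_primitive_6th_root[OF norm(2) _ 3(2)]) (simp only: p(1)[symmetric] 3(1))
    moreover have "z \<noteq> -1" using 3(2) by auto
    then have "w = beta q / 18" using 3(2) unfolding w_def u 3(1) p(2) by simp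
    moreover have "0 \<le> beta q" using tr_le_2[OF q(2), of 4] by (simp add: densities_tr)
    ultimately show ?thesis unfolding t7 by simp
  next
    case 4
    have "z ^ 9 = -1" if "z ^ 3 = -1" unfolding p(1) that by simp
    then have "z ^ 3 \<noteq> -1" using 4 by blast
    moreover from this have "z \<noteq> -1" by auto
    ultimately have "w = 0" using 4 unfolding w_def u p(2) by simp
    then show ?thesis by simp
  qed
qed

lemma circular_measure_E7:
  "circular_measure E7_graph = (\<lambda>S. with_density beta (d_odd 9) S + (measure (d_odd 1) S - measure (d_odd 3) S) / 2)"
proof
  fix S
  let ?X = "E7_graph" and ?R = "roots_of_unity 36"
  define w where "w q = odd_weight 9 q * beta q + (odd_weight 1 q - odd_weight 3 q) / 2" for q
  define f where "f v q = [tr 1 q + tr 3 q, 1 + tr 2 q, tr 1 q, 1, 1 + tr 2 q - tr 6 q, tr 4 q + tr 6 q, tr 5 q] ! v" for v q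
  have vs: "v = 0 \<or> v = 1 \<or> v = 2 \<or> v = 3 \<or> v = 4 \<or> v = 5 \<or> v = 6" if "v \<le> 3 + 1 + 2" for v :: nat
    using that by auto
  have mom: "(\<Sum>q\<in>?R. w q * tr j q) = (\<Sum>q\<in>?R. odd_weight 9 q * tr j q) - (\<Sum>q\<in>?R. odd_weight 9 q * (tr 4 q * tr j q)) / 2
    + ((\<Sum>q\<in>?R. odd_weight 1 q * tr j q) - (\<Sum>q\<in>?R. odd_weight 3 q * tr j q)) / 2" for j
    unfolding sum_divide_distrib sum.distrib[symmetric] sum_subtractf[symmetric]
    by (rule sum.cong) (simp_all add: w_def densities_tr field_simps)
  have "(\<Sum>q\<in>?R. w q * tr 0 q) = 2"
    unfolding mom by (simp add: sum_odd_tr sum_odd_tr_tr del: tr_0)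
  then have one: "(\<Sum>q\<in>?R. w q) = 1"
    by (simp flip: sum_distrib_right)
  have "circular_measure ?X S = (\<Sum>q\<in>?R. w q * indicator S q)"
    unfolding E7_graph_def
  proof (rule circular_measure_three_legs[where f = f])
    fix q :: complex and v :: nat
    assume q: "q ^ 36 = 1" "norm q = 1" "w q \<noteq> 0" and v: "v \<le> 3 + 1 + 2"
    have rel: "tr 7 q = tr 1 q - tr 5 q" using E7_weight_support[OF q(1,2)] q(3) by (auto simp: w_def)
    show "(if v = 0 then f 1 q + f (3 + 1) q + f (3 + 1 + 1) q
       else f (if v = 3 + 1 \<or> v = 3 + 1 + 1 then 0 else v - 1) q
        + (if v = 3 \<or> v = 3 + 1 \<or> v = 3 + 1 + 2 then 0 else f (Suc v) q)) = tr 1 q * f v q"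
      using vs[OF v] by (elim disjE) (simp_all add: f_def distrib_left right_diff_distrib rel
        tr_1_mult[OF q(2), unfolded One_nat_def])
  next
    fix v :: nat assume v: "v \<le> 3 + 1 + 2"
    show "(\<Sum>q\<in>?R. w q * f v q) = (if v = 3 then 1 else 0)"
      using vs[OF v] one by (elim disjE)
        (simp_all add: f_def distrib_left right_diff_distrib sum.distrib sum_subtractf mom
          sum_odd_tr sum_odd_tr_tr del: tr_0)
  qed (use E7_weight_support in \<open>auto simp: w_def f_def densities_tr\<close>)
  also have "\<dots> = with_density beta (d_odd 9) S + (measure (d_odd 1) S - measure (d_odd 3) S) / 2"
  proof -
    have "\<And>l. with_density l (d_odd 9) S = (\<Sum>q\<in>?R. odd_weight 9 q * l q * indicator S q)"
      "\<And>l. with_density l (d_odd 1) S = (\<Sum>q\<in>?R. odd_weight 1 q * l q * indicator S q)"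
      "\<And>l. with_density l (d_odd 3) S = (\<Sum>q\<in>?R. odd_weight 3 q * l q * indicator S q)"
      by (rule with_density_odd; simp)+
    then show ?thesis
      unfolding measure_eq_with_density
      by (simp only: sum.distrib[symmetric] sum_subtractf[symmetric] sum_divide_distrib)
         (rule sum.cong, simp_all add: w_def field_simps)
  qed
  finally show "circular_measure ?X S = with_density beta (d_odd 9) S + (measure (d_odd 1) S - measure (d_odd 3) S) / 2" .
qed

text \<open>
  With \<open>z = q\<^sup>2\<close>, a thirtieth root of unity, the weight is supported where \<open>z\<close> has order \<open>30\<close>; for
  the orders \<open>2\<close>, \<open>6\<close> and \<open>10\<close> the summands cancel.
\<close>

lemma E8_weight_support:
  assumes q: "q ^ 60 = 1" "norm q = 1"
  defines "w \<equiv> odd_weight 15 q * alpha q + odd_weight 15 q * gamma q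
    - (odd_weight 5 q + odd_weight 3 q) / 2"
  shows "0 \<le> w \<and> (w = 0 \<or> tr 8 q = 1 + tr 2 q - tr 6 q)"
proof -
  define z where "z = q\<^sup>2"
  have norm: "norm z = 1" using q(2) by (auto simp: z_def norm_power)
  then have zc: "z * cnj z = 1" by (simp add: complex_mult_cnj flip: cmod_power2)
  have u: "odd_weight n q = (if z ^ n = -1 then 1 / (2 * n) else 0)" for n
    by (simp add: odd_weight_def z_def power_mult)
  have t: "tr 2 q = 2 * Re z" "tr 4 q = 2 * Re (z\<^sup>2)" "tr 6 q = 2 * Re (z ^ 3)" "tr 8 q = 2 * Re (z ^ 4)"
    by (simp_all add: tr_def z_def flip: power_mult)
  have p: "z ^ 15 = (z ^ 3) ^ 5" "z ^ 15 = (z ^ 5) ^ 3" "z ^ 5 = z ^ 3 * z\<^sup>2"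
    by (simp_all flip: power_mult power_add)
  consider "z = -1" | "z ^ 3 = -1" "z \<noteq> -1" | "z ^ 5 = -1" "z \<noteq> -1" "z ^ 3 \<noteq> -1"
    | "z ^ 15 = -1" "z ^ 3 \<noteq> -1" "z ^ 5 \<noteq> -1" | "z ^ 15 \<noteq> -1" by blast
  then show ?thesis
  proof cases
    case 1
    have "w = 0" unfolding w_def u densities_tr t 1 by simp
    then show ?thesis by simp
  next
    case 2
    have "tr 2 q = 1" unfolding t(1) by (rule Re_primitive_6th_root[OF norm 2])
    moreover have "tr 6 q = -2" unfolding t(3) 2(1) by simp
    moreover have "z\<^sup>2 \<noteq> 1" unfolding power2_eq_1_iff using 2 by auto
    then have "z ^ 5 \<noteq> -1" unfolding p(3) 2(1) by simp
    moreover have "z ^ 15 = -1" unfolding p(1) 2(1) by simp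
    ultimately have "w = 0" unfolding w_def u densities_tr 2(1) by simp
    then show ?thesis by simp
  next
    case 3
    \<comment> \<open>The second factor on the left is the cyclotomic polynomial of order \<open>10\<close>.\<close>
    have "(z + 1) * (z ^ 4 - z ^ 3 + z\<^sup>2 - z + 1) = z ^ 5 + 1"
      by (simp add: algebra_simps eval_nat_numeral)
    then have "(z + 1) * (z ^ 4 - z ^ 3 + z\<^sup>2 - z + 1) = 0" using 3(1) by simp
    moreover have "z + 1 \<noteq> 0" using 3(2) by (simp add: add_eq_0_iff2)
    ultimately have "z ^ 4 - z ^ 3 + z\<^sup>2 - z + 1 = 0" using mult_eq_0_iff by blast
    then have "z\<^sup>2 - z + 1 - cnj z + (cnj z)\<^sup>2 = 0" using zc by algebra
    then have "Re (z\<^sup>2 - z + 1 - cnj z + (cnj z)\<^sup>2) = 0" by simp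
    then have "tr 4 q = tr 2 q - 1" unfolding t by (simp flip: complex_cnj_power)
    moreover have "z ^ 3 = - (cnj z)\<^sup>2" using 3(1) zc by algebra
    then have "tr 6 q = - tr 4 q" unfolding t by (simp flip: complex_cnj_power)
    moreover have "z ^ 15 = -1" unfolding p(2) 3(1) by simp
    ultimately have "w = 0" using 3(3) unfolding w_def u densities_tr 3(1) by (simp add: field_simps)
    then show ?thesis by simp
  next
    case 4
    \<comment> \<open>The last factor on the left is the cyclotomic polynomial of order \<open>30\<close>. Dividing it by \<open>z\<^sup>4\<close> and
    taking real parts gives the relation between the values of \<open>tr\<close>.\<close>
    have "(z ^ 3 + 1) * (z ^ 5 + 1) * (z ^ 8 + z ^ 7 - z ^ 5 - z ^ 4 - z ^ 3 + z + 1) = (z ^ 15 + 1) * (z + 1)"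
      by (simp add: algebra_simps eval_nat_numeral)
    then have "(z ^ 3 + 1) * (z ^ 5 + 1) * (z ^ 8 + z ^ 7 - z ^ 5 - z ^ 4 - z ^ 3 + z + 1) = 0" using 4(1) by simp
    moreover have "(z ^ 3 + 1) * (z ^ 5 + 1) \<noteq> 0" using 4(2,3) by (simp add: add_eq_0_iff2)
    ultimately have "z ^ 8 + z ^ 7 - z ^ 5 - z ^ 4 - z ^ 3 + z + 1 = 0" using mult_eq_0_iff by blast
    then have "z ^ 4 + z ^ 3 - z - 1 - cnj z + cnj z ^ 3 + cnj z ^ 4 = 0" using zc by algebra
    then have "Re (z ^ 4 + z ^ 3 - z - 1 - cnj z + cnj z ^ 3 + cnj z ^ 4) = 0" by simp
    then have "tr 8 q = 1 + tr 2 q - tr 6 q" unfolding t by (simp flip: complex_cnj_power)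
    moreover have "w = (alpha q + gamma q) / 30" using 4(2,3) unfolding w_def u 4(1) by simp
    moreover have "0 \<le> gamma q" using tr_le_2[OF q(2), of 6] by (simp add: densities_tr)
    ultimately show ?thesis using alpha_nonneg[OF q(2)] by simp
  next
    case 5
    have "z ^ 15 = -1" if "z ^ 3 = -1" unfolding p(1) that by simp
    moreover have "z ^ 15 = -1" if "z ^ 5 = -1" unfolding p(2) that by simp
    ultimately have "z ^ 3 \<noteq> -1" "z ^ 5 \<noteq> -1" using 5 by blast+
    then have "w = 0" using 5 unfolding w_def u by simp
    then show ?thesis by simp
  qed
qed

lemma circular_measure_E8:
  "circular_measure E8_graph = (\<lambda>S. with_density alpha (d_odd 15) S + with_density gamma (d_odd 15) S
    - (measure (d_odd 5) S + measure (d_odd 3) S) / 2)"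
proof
  fix S
  let ?X = "E8_graph" and ?R = "roots_of_unity 60"
  define w where "w q = odd_weight 15 q * alpha q + odd_weight 15 q * gamma q - (odd_weight 5 q + odd_weight 3 q) / 2" for q
  define f where "f v q =
    [1 + tr 2 q + tr 4 q, tr 1 q + tr 3 q, 1 + tr 2 q, tr 1 q, 1, tr 1 q + tr 3 q - tr 7 q,
      tr 5 q + tr 7 q, tr 6 q] ! v" for v q
  have vs: "v = 0 \<or> v = 1 \<or> v = 2 \<or> v = 3 \<or> v = 4 \<or> v = 5 \<or> v = 6 \<or> v = 7" if "v \<le> 4 + 1 + 2" for v :: nat
    using that by auto
  have mom: "(\<Sum>q\<in>?R. w q * tr j q) = (\<Sum>q\<in>?R. odd_weight 15 q * tr j q) - (\<Sum>q\<in>?R. odd_weight 15 q * (tr 2 q * tr j q)) / 2 + (\<Sum>q\<in>?R. odd_weight 15 q * tr j q)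
    - (\<Sum>q\<in>?R. odd_weight 15 q * (tr 6 q * tr j q)) / 2 - ((\<Sum>q\<in>?R. odd_weight 5 q * tr j q) + (\<Sum>q\<in>?R. odd_weight 3 q * tr j q)) / 2" for j
    unfolding sum_divide_distrib sum.distrib[symmetric] sum_subtractf[symmetric]
    by (rule sum.cong) (simp_all add: w_def densities_tr field_simps)
  have "(\<Sum>q\<in>?R. w q * tr 0 q) = 2"
    unfolding mom by (simp add: sum_odd_tr sum_odd_tr_tr del: tr_0)
  then have one: "(\<Sum>q\<in>?R. w q) = 1"
    by (simp flip: sum_distrib_right)
  have "circular_measure ?X S = (\<Sum>q\<in>?R. w q * indicator S q)"
    unfolding E8_graph_def
  proof (rule circular_measure_three_legs[where f = f])
    fix q :: complex and v :: nat
    assume q: "q ^ 60 = 1" "norm q = 1" "w q \<noteq> 0" and v: "v \<le> 4 + 1 + 2"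
    have rel: "tr 8 q = 1 + tr 2 q - tr 6 q" using E8_weight_support[OF q(1,2)] q(3) by (auto simp: w_def)
    show "(if v = 0 then f 1 q + f (4 + 1) q + f (4 + 1 + 1) q
       else f (if v = 4 + 1 \<or> v = 4 + 1 + 1 then 0 else v - 1) q
        + (if v = 4 \<or> v = 4 + 1 \<or> v = 4 + 1 + 2 then 0 else f (Suc v) q)) = tr 1 q * f v q"
      using vs[OF v] by (elim disjE) (simp_all add: f_def distrib_left right_diff_distrib rel
        tr_1_mult[OF q(2), unfolded One_nat_def])
  next
    fix v :: nat assume v: "v \<le> 4 + 1 + 2"
    show "(\<Sum>q\<in>?R. w q * f v q) = (if v = 4 then 1 else 0)"
      using vs[OF v] one by (elim disjE)
        (simp_all add: f_def distrib_left right_diff_distrib sum.distrib sum_subtractf mom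
          sum_odd_tr sum_odd_tr_tr del: tr_0)
  qed (use E8_weight_support in \<open>auto simp: w_def f_def densities_tr\<close>)
  also have "\<dots> = with_density alpha (d_odd 15) S + with_density gamma (d_odd 15) S
    - (measure (d_odd 5) S + measure (d_odd 3) S) / 2"
  proof -
    have "\<And>l. with_density l (d_odd 15) S = (\<Sum>q\<in>?R. odd_weight 15 q * l q * indicator S q)"
      "\<And>l. with_density l (d_odd 5) S = (\<Sum>q\<in>?R. odd_weight 5 q * l q * indicator S q)"
      "\<And>l. with_density l (d_odd 3) S = (\<Sum>q\<in>?R. odd_weight 3 q * l q * indicator S q)"
      by (rule with_density_odd; simp)+
    then show ?thesis
      unfolding measure_eq_with_density
      by (simp only: sum.distrib[symmetric] sum_subtractf[symmetric] sum_divide_distrib)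
         (rule sum.cong, simp_all add: w_def field_simps)
  qed
  finally show "circular_measure ?X S = with_density alpha (d_odd 15) S + with_density gamma (d_odd 15) S
    - (measure (d_odd 5) S + measure (d_odd 3) S) / 2" .
qed

section \<open>Affine trees with three legs\<close>

definition affine_weight :: "nat \<Rightarrow> complex \<Rightarrow> real" where
  "affine_weight n q = (unif_weight n q + unif_weight 3 q + unif_weight 2 q - unif_weight 1 q) / 2"

text \<open>
  The order \<open>120\<close> is a multiple of \<open>2n\<close> for \<open>n = 1, \<dots>, 5\<close>, so one summation range serves all three graphs.
\<close>

lemma sum_affine_weight_tr:
  assumes "n \<in> {3, 4, 5}"
  shows "(\<Sum>q\<in>roots_of_unity 120. affine_weight n q * tr j q)
    = ((if 2 * n dvd j then 2 else 0) + (if 6 dvd j then 2 else 0) + (if 4 dvd j then 2 else 0)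
        - (if 2 dvd j then 2 else 0)) / 2"
proof -
  have "(\<Sum>q\<in>roots_of_unity 120. affine_weight n q * tr j q)
      = ((\<Sum>q\<in>roots_of_unity 120. unif_weight n q * tr j q)
        + (\<Sum>q\<in>roots_of_unity 120. unif_weight 3 q * tr j q)
        + (\<Sum>q\<in>roots_of_unity 120. unif_weight 2 q * tr j q)
        - (\<Sum>q\<in>roots_of_unity 120. unif_weight 1 q * tr j q)) / 2"
    unfolding sum_divide_distrib sum.distrib[symmetric] sum_subtractf[symmetric]
    by (rule sum.cong) (simp_all add: affine_weight_def field_simps)
  moreover have "1 \<le> n" "2 * n dvd 120" using assms by auto
  ultimately show ?thesis by (simp add: sum_unif_tr)
qed

lemma sum_affine_weight:
  assumes "n \<in> {3, 4, 5}"
  shows "(\<Sum>q\<in>roots_of_unity 120. affine_weight n q) = 1"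
  using sum_affine_weight_tr[OF assms, of 0] by (simp flip: sum_distrib_right)

text \<open>
  Only \<open>d\<^sub>1\<close> enters with a negative sign. At its support \<open>\<plusminus>1\<close> all summands contribute, and the sum is positive because
  \<open>1/n + 1/3 + 1/2 > 1\<close> for \<open>n < 6\<close>, the inequality behind the platonic solids.
\<close>

lemma affine_weight_nonneg:
  assumes "n \<in> {3, 4, 5}"
  shows "0 \<le> affine_weight n q"
proof (cases "q\<^sup>2 = 1")
  case True
  then have "unif_weight k q = 1 / (2 * k)" for k by (simp add: unif_weight_def power_mult)
  then show ?thesis using assms by (auto simp: affine_weight_def)
next
  case False
  then have "unif_weight 1 q = 0" by (simp add: unif_weight_def)
  then show ?thesis by (simp add: affine_weight_def unif_weight_nonneg)
qed

text \<open>
  The points \<open>\<plusminus>1\<close> are also sixth roots of unity, so every point of the support has order dividing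
  \<open>2n\<close>, \<open>6\<close> or \<open>4\<close>.
\<close>

lemma circular_measure_affine_three_legs:
  fixes f :: "nat \<Rightarrow> complex \<Rightarrow> real"
  assumes n: "n \<in> {3, 4, 5}" and legs: "a \<ge> 1" "b \<ge> 1" "c \<ge> 1"
    and eig: "\<And>q v. norm q = 1 \<Longrightarrow> q ^ (2 * n) = 1 \<or> q ^ 6 = 1 \<or> q ^ 4 = 1 \<Longrightarrow> v \<le> a + b + c \<Longrightarrow>
      (if v = 0 then f 1 q + f (a + 1) q + f (a + b + 1) q
       else f (if v = a + 1 \<or> v = a + b + 1 then 0 else v - 1) q
         + (if v = a \<or> v = a + b \<or> v = a + b + c then 0 else f (Suc v) q)) = tr 1 q * f v q"
    and unit: "\<And>v. v \<le> a + b + c \<Longrightarrow>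
      (\<Sum>q\<in>roots_of_unity 120. affine_weight n q * f v q) = (if v = a then 1 else 0)"
    and root: "\<And>q. f a q = 1"
  shows "circular_measure (three_legs a b c) S
    = (measure (d_unif n) S + measure (d_unif 3) S + measure (d_unif 2) S - measure (d_unif 1) S) / 2"
proof -
  have "circular_measure (three_legs a b c) S
      = (\<Sum>q\<in>roots_of_unity 120. affine_weight n q * indicator S q)"
  proof (rule circular_measure_three_legs[OF legs, where f = f])
    fix q :: complex and v :: nat assume q: "norm q = 1" "affine_weight n q \<noteq> 0" and v: "v \<le> a + b + c"
    have "q ^ 6 = 1" if "q\<^sup>2 = 1"
    proof -
      have "q ^ 6 = (q\<^sup>2) ^ 3" by (simp flip: power_mult)
      then show ?thesis unfolding that by simp
    qed
    then have "q ^ (2 * n) = 1 \<or> q ^ 6 = 1 \<or> q ^ 4 = 1"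
      using q(2) by (auto simp: affine_weight_def unif_weight_def split: if_splits)
    then show "(if v = 0 then f 1 q + f (a + 1) q + f (a + b + 1) q
       else f (if v = a + 1 \<or> v = a + b + 1 then 0 else v - 1) q
         + (if v = a \<or> v = a + b \<or> v = a + b + c then 0 else f (Suc v) q)) = tr 1 q * f v q"
      by (rule eig[OF q(1) _ v])
  qed (use unit root affine_weight_nonneg[OF n] in \<open>auto simp: affine_weight_def\<close>)
  also have "\<dots> = (measure (d_unif n) S + measure (d_unif 3) S + measure (d_unif 2) S - measure (d_unif 1) S) / 2"
  proof -
    have "with_density (\<lambda>_. 1) (d_unif k) S = (\<Sum>q\<in>roots_of_unity 120. unif_weight k q * 1 * indicator S q)"
      if "k \<in> {1, 2, 3, 4, 5}" for k
      by (rule with_density_unif) (use that in auto)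
    note this[of n] this[of 3] this[of 2] this[of 1]
    then show ?thesis using n
      unfolding measure_eq_with_density
      by (simp del: sum_mult_indicator add: affine_weight_def left_diff_distrib distrib_right add_divide_distrib
          diff_divide_distrib sum.distrib sum_subtractf sum_divide_distrib)
  qed
  finally show ?thesis .
qed

text \<open>
  The two legs without the root are interchanged by a symmetry that fixes the root, so they carry
  equal components. The relation on the support is \<open>tr 5 q = tr 1 q\<close>.
\<close>

lemma circular_measure_E6_tilde:
  "circular_measure (three_legs 2 2 2) S
    = (measure (d_unif 3) S + measure (d_unif 3) S + measure (d_unif 2) S - measure (d_unif 1) S) / 2"
proof -
  define f where "f v q = [1 + tr 2 q, tr 1 q, 1, (tr 1 q + tr 3 q) / 2, tr 4 q / 2, (tr 1 q + tr 3 q) / 2, tr 4 q / 2] ! v" for v q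
  have vs: "v = 0 \<or> v = 1 \<or> v = 2 \<or> v = 3 \<or> v = 4 \<or> v = 5 \<or> v = 6" if "v \<le> 2 + 2 + 2" for v :: nat
    using that by auto
  show ?thesis
  proof (rule circular_measure_affine_three_legs[where f = f])
    fix q :: complex and v :: nat assume q: "norm q = 1" "q ^ (2 * 3) = 1 \<or> q ^ 6 = 1 \<or> q ^ 4 = 1" and v: "v \<le> 2 + 2 + 2"
    have rel: "tr 5 q = tr 1 q"
      using q(2)
    proof (elim disjE)
      assume "q ^ (2 * 3) = 1"
      then show ?thesis using tr_reflect_1[OF q(1), of 1 5] by simp
    next
      assume "q ^ 6 = 1"
      then show ?thesis using tr_reflect_1[OF q(1), of 1 5] by simp
    next
      assume "q ^ 4 = 1"
      then show ?thesis using tr_period[of q 4 1] by simp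
    qed
    show "(if v = 0 then f 1 q + f (2 + 1) q + f (2 + 2 + 1) q
       else f (if v = 2 + 1 \<or> v = 2 + 2 + 1 then 0 else v - 1) q
        + (if v = 2 \<or> v = 2 + 2 \<or> v = 2 + 2 + 2 then 0 else f (Suc v) q)) = tr 1 q * f v q"
      using vs[OF v] by (elim disjE) (simp_all add: f_def distrib_left right_diff_distrib add_divide_distrib
        diff_divide_distrib rel
        mult.left_commute[of _ 2] tr_1_mult[OF q(1), unfolded One_nat_def])
  next
    fix v :: nat assume v: "v \<le> 2 + 2 + 2"
    show "(\<Sum>q\<in>roots_of_unity 120. affine_weight 3 q * f v q) = (if v = 2 then 1 else 0)"
      using vs[OF v] by (elim disjE) (simp_all add: f_def distrib_left right_diff_distrib add_divide_distrib
        diff_divide_distrib sum.distrib sum_subtractf sum_affine_weight_tr sum_affine_weight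
        mult.left_commute[of _ 2] flip: sum_divide_distrib sum_distrib_left sum_distrib_right)
  qed (simp_all add: f_def)
qed

text \<open>
  The eigenvalue \<open>0\<close> is double here. The eigenvector equation alone leaves a free multiple of the
  eigenvector that vanishes at the root; the thirds in the components are what orthogonality dictates.
\<close>

lemma circular_measure_E7_tilde:
  "circular_measure (three_legs 3 1 3) S
    = (measure (d_unif 4) S + measure (d_unif 3) S + measure (d_unif 2) S - measure (d_unif 1) S) / 2"
proof -
  define f where "f v q =
    [tr 1 q + tr 3 q, 1 + tr 2 q, tr 1 q, 1, (2 + 2 * tr 2 q + tr 4 q - tr 6 q) / 3,
      (1 + tr 2 q + 2 * tr 4 q + tr 6 q) / 3, tr 5 q, (tr 4 q + 2 * tr 6 q - tr 2 q - 1) / 3] ! v" for v q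
  have vs: "v = 0 \<or> v = 1 \<or> v = 2 \<or> v = 3 \<or> v = 4 \<or> v = 5 \<or> v = 6 \<or> v = 7" if "v \<le> 3 + 1 + 3" for v :: nat
    using that by auto
  show ?thesis
  proof (rule circular_measure_affine_three_legs[where f = f])
    fix q :: complex and v :: nat assume q: "norm q = 1" "q ^ (2 * 4) = 1 \<or> q ^ 6 = 1 \<or> q ^ 4 = 1" and v: "v \<le> 3 + 1 + 3"
    have rel: "tr 7 q = tr 1 q"
      using q(2)
    proof (elim disjE)
      assume "q ^ (2 * 4) = 1"
      then show ?thesis using tr_reflect_1[OF q(1), of 1 7] by simp
    next
      assume "q ^ 6 = 1"
      then show ?thesis using tr_period[of q 6 1] by simp
    next
      assume "q ^ 4 = 1"
      then have "q ^ 8 = 1" using power_mult[of q 4 2] by simp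
      then show ?thesis using tr_reflect_1[OF q(1), of 1 7] by simp
    qed
    show "(if v = 0 then f 1 q + f (3 + 1) q + f (3 + 1 + 1) q
       else f (if v = 3 + 1 \<or> v = 3 + 1 + 1 then 0 else v - 1) q
        + (if v = 3 \<or> v = 3 + 1 \<or> v = 3 + 1 + 3 then 0 else f (Suc v) q)) = tr 1 q * f v q"
      using vs[OF v] by (elim disjE) (simp_all add: f_def distrib_left right_diff_distrib add_divide_distrib
        diff_divide_distrib rel
        mult.left_commute[of _ 2] tr_1_mult[OF q(1), unfolded One_nat_def])
  next
    fix v :: nat assume v: "v \<le> 3 + 1 + 3"
    show "(\<Sum>q\<in>roots_of_unity 120. affine_weight 4 q * f v q) = (if v = 3 then 1 else 0)"
      using vs[OF v] by (elim disjE) (simp_all add: f_def distrib_left right_diff_distrib add_divide_distrib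
        diff_divide_distrib sum.distrib sum_subtractf sum_affine_weight_tr sum_affine_weight
        mult.left_commute[of _ 2] flip: sum_divide_distrib sum_distrib_left sum_distrib_right)
  qed (simp_all add: f_def)
qed

lemma circular_measure_E8_tilde:
  "circular_measure (three_legs 5 1 2) S
    = (measure (d_unif 5) S + measure (d_unif 3) S + measure (d_unif 2) S - measure (d_unif 1) S) / 2"
proof -
  define f where "f v q =
    [tr 1 q + tr 3 q + tr 5 q, 1 + tr 2 q + tr 4 q, tr 1 q + tr 3 q, 1 + tr 2 q,
      tr 1 q, 1, 1 + tr 2 q + tr 4 q - tr 8 q, tr 6 q + tr 8 q, tr 7 q] ! v" for v q
  have vs: "v = 0 \<or> v = 1 \<or> v = 2 \<or> v = 3 \<or> v = 4 \<or> v = 5 \<or> v = 6 \<or> v = 7 \<or> v = 8" if "v \<le> 5 + 1 + 2" for v :: nat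
    using that by auto
  show ?thesis
  proof (rule circular_measure_affine_three_legs[where f = f])
    fix q :: complex and v :: nat assume q: "norm q = 1" "q ^ (2 * 5) = 1 \<or> q ^ 6 = 1 \<or> q ^ 4 = 1" and v: "v \<le> 5 + 1 + 2"
    have rel: "tr 9 q = tr 3 q + tr 1 q - tr 7 q"
      using q(2)
    proof (elim disjE)
      assume "q ^ (2 * 5) = 1"
      then show ?thesis using tr_reflect_1[OF q(1), of 1 9] tr_reflect_1[OF q(1), of 3 7] by simp
    next
      assume "q ^ 6 = 1"
      then show ?thesis using tr_period[of q 6 1] tr_period[of q 6 3] by simp
    next
      assume "q ^ 4 = 1"
      then show ?thesis using tr_period[of q 4 3] tr_period[of q 8 1] power_mult[of q 4 2] by simp
    qed
    show "(if v = 0 then f 1 q + f (5 + 1) q + f (5 + 1 + 1) q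
       else f (if v = 5 + 1 \<or> v = 5 + 1 + 1 then 0 else v - 1) q
        + (if v = 5 \<or> v = 5 + 1 \<or> v = 5 + 1 + 2 then 0 else f (Suc v) q)) = tr 1 q * f v q"
      using vs[OF v] by (elim disjE) (simp_all add: f_def distrib_left right_diff_distrib add_divide_distrib
        diff_divide_distrib rel
        mult.left_commute[of _ 2] tr_1_mult[OF q(1), unfolded One_nat_def])
  next
    fix v :: nat assume v: "v \<le> 5 + 1 + 2"
    show "(\<Sum>q\<in>roots_of_unity 120. affine_weight 5 q * f v q) = (if v = 5 then 1 else 0)"
      using vs[OF v] by (elim disjE) (simp_all add: f_def distrib_left right_diff_distrib add_divide_distrib
        diff_divide_distrib sum.distrib sum_subtractf sum_affine_weight_tr sum_affine_weight
        mult.left_commute[of _ 2] flip: sum_divide_distrib sum_distrib_left sum_distrib_right)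
  qed (simp_all add: f_def)
qed

section \<open>The circular measures of the ADE graphs\<close>

theorem theorem7p1:
  shows "(\<forall>n\<ge>3. circular_measure (A_graph (n - 1)) = with_density alpha (d_unif n))
    \<and> (\<forall>n\<ge>1. circular_measure (A_tilde_graph (2 * n)) = (\<lambda>S. measure (d_unif n) S))
    \<and> (\<forall>n\<ge>2. circular_measure (D_graph (n + 1)) = with_density alpha (d_odd n))
    \<and> (\<forall>n\<ge>2. circular_measure (D_tilde_graph (n + 2)) =
          (\<lambda>S. (measure (d_unif n) S + measure (d_odd 1) S) / 2))
    \<and> circular_measure E6_graph =
          (\<lambda>S. with_density alpha (d_unif 12) S
            + (measure (d_unif 12) S - measure (d_unif 6) S
                - measure (d_unif 4) S + measure (d_unif 3) S) / 2)
    \<and> circular_measure E7_graph =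
          (\<lambda>S. with_density beta (d_odd 9) S + (measure (d_odd 1) S - measure (d_odd 3) S) / 2)
    \<and> circular_measure E8_graph =
          (\<lambda>S. with_density alpha (d_odd 15) S + with_density gamma (d_odd 15) S
            - (measure (d_odd 5) S + measure (d_odd 3) S) / 2)
    \<and> (\<forall>n\<in>{3, 4, 5}. circular_measure (E_tilde_graph (n + 3)) =
          (\<lambda>S. (measure (d_unif n) S + measure (d_unif 3) S
                 + measure (d_unif 2) S - measure (d_unif 1) S) / 2))"
proof (intro conjI allI impI ballI)
  fix n :: nat
  show "circular_measure (A_graph (n - 1)) = with_density alpha (d_unif n)" if "3 \<le> n"
    using that by (rule circular_measure_A)
  show "circular_measure (A_tilde_graph (2 * n)) = (\<lambda>S. measure (d_unif n) S)" if "1 \<le> n"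
    using that by (rule circular_measure_A_tilde)
  show "circular_measure (D_graph (n + 1)) = with_density alpha (d_odd n)" if "2 \<le> n"
    using that by (rule circular_measure_D)
  show "circular_measure (D_tilde_graph (n + 2)) =
      (\<lambda>S. (measure (d_unif n) S + measure (d_odd 1) S) / 2)" if "2 \<le> n"
    using that by (rule circular_measure_D_tilde)
  show "circular_measure (E_tilde_graph (n + 3)) =
      (\<lambda>S. (measure (d_unif n) S + measure (d_unif 3) S
        + measure (d_unif 2) S - measure (d_unif 1) S) / 2)" if "n \<in> {3, 4, 5}"
  proof -
    from that consider "n = 3" | "n = 4" | "n = 5" by blast
    then show ?thesis
      by cases (simp_all add: E_tilde_graph_def fun_eq_iff circular_measure_E6_tilde
        circular_measure_E7_tilde circular_measure_E8_tilde del: One_nat_def)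
  qed
qed (fact circular_measure_E6 circular_measure_E7 circular_measure_E8)+

end
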